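(* Let $\mathbb{U}$ be a monster model of $\operatorname{Th}(\mathcal{U})$ and fix an integer $n\geq 1$. (a) Every indiscernible sequence $(\bar a^l)_{l<\omega}$ in $\mathbb{U}$ of tuples of length $n$ is $(n+1)$-cyclic. (b) There is an indiscernible sequence $(\bar a^l)_{l<\omega}$ in $\mathbb{U}$ of tuples of length $n$ that is not $n$-cyclic.
   Context: $\mathcal{U}$ is the Urysohn sphere (the unique complete separable metric space of diameter 1 that is ultrahomogeneous and universal for separable metric spaces of diameter $\le 1$), viewed as a continuous-logic structure in the language with only the metric; $\mathbb{U}$ is a sufficiently saturated model of its theory. A sequence $(\bar a^l)_{l<\omega}$ is indiscernible if for every formula $\varphi(\bar x_1,\dots,\bar x_m)$ and all $l_1<\dots<l_m$, $k_1<\dots<k_m$, $\varphi(\bar a^{l_1},\dots,\bar a^{l_m})=\varphi(\bar a^{k_1},\dots,\bar a^{k_m})$. For an indiscernible sequence with $p(\bar x,\bar y)=\operatorname{tp}(\bar a^0,\bar a^1)$ and $m\ge1$, the sequence is $m$-cyclic if $p(\bar x^1,\bar x^2)\cup p(\bar x^2,\bar x^3)\cup\dots\cup p(\bar x^{m-1},\bar x^m)\cup p(\bar x^m,\bar x^1)$ is satisfiable (for $m=1$ this is $p(\bar x^1,\bar x^1)$). *)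

theory Defs
  imports "HOL-Analysis.Analysis"
begin

section \<open>Continuous logic in the language of the metric\<close>

text \<open>
  Continuous first-order logic with truth values in the unit interval, the value 0 meaning ``true''.
  The only non-logical symbol is the metric, variables are natural numbers, and every continuous
  function from a finite power of the unit interval to the unit interval is a connective.
\<close>

datatype form =
    Dist nat nat
  | Conn "real list \<Rightarrow> real" "form list"
  | SupQ nat form
  | InfQ nat form

definition connective :: "nat \<Rightarrow> (real list \<Rightarrow> real) \<Rightarrow> bool" where
  "connective k u \<longleftrightarrow>
     continuous_map (product_topology (\<lambda>_. top_of_set {0..1::real}) {..<k}) (top_of_set {0..1})
       (\<lambda>x. u (map x [0..<k]))"

fun wff :: "form \<Rightarrow> bool" where
  "wff (Dist i j) \<longleftrightarrow> True"
| "wff (Conn u \<phi>s) \<longleftrightarrow> connective (length \<phi>s) u \<and> (\<forall>\<phi>\<in>set \<phi>s. wff \<phi>)"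
| "wff (SupQ i \<phi>) \<longleftrightarrow> wff \<phi>"
| "wff (InfQ i \<phi>) \<longleftrightarrow> wff \<phi>"

fun fv :: "form \<Rightarrow> nat set" where
  "fv (Dist i j) = {i, j}"
| "fv (Conn u \<phi>s) = (\<Union>\<phi>\<in>set \<phi>s. fv \<phi>)"
| "fv (SupQ i \<phi>) = fv \<phi> - {i}"
| "fv (InfQ i \<phi>) = fv \<phi> - {i}"

fun val :: "'a metric \<Rightarrow> form \<Rightarrow> (nat \<Rightarrow> 'a) \<Rightarrow> real" where
  "val M (Dist i j) v = mdist M (v i) (v j)"
| "val M (Conn u \<phi>s) v = u (map (\<lambda>\<phi>. val M \<phi> v) \<phi>s)"
| "val M (SupQ i \<phi>) v = (SUP a\<in>mspace M. val M \<phi> (v(i := a)))"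
| "val M (InfQ i \<phi>) v = (INF a\<in>mspace M. val M \<phi> (v(i := a)))"

text \<open>Only the free variables matter, so values of the assignment elsewhere are irrelevant.\<close>

lemma val_cong: "(\<And>i. i \<in> fv \<phi> \<Longrightarrow> v i = w i) \<Longrightarrow> val M \<phi> v = val M \<phi> w"
proof (induction \<phi> arbitrary: v w)
  case (Conn u \<phi>s)
  have "val M \<phi> v = val M \<phi> w" if "\<phi> \<in> set \<phi>s" for \<phi>
    by (rule Conn.IH[OF that]) (use Conn.prems that in auto)
  then have "map (\<lambda>\<phi>. val M \<phi> v) \<phi>s = map (\<lambda>\<phi>. val M \<phi> w) \<phi>s"
    by (rule map_cong[OF refl])
  then show ?case by (simp only: val.simps)
next
  case (SupQ i \<phi>)
  have "val M \<phi> (v(i := a)) = val M \<phi> (w(i := a))" for a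
    by (rule SupQ.IH) (use SupQ.prems in auto)
  then show ?case by (simp only: val.simps)
next
  case (InfQ i \<phi>)
  have "val M \<phi> (v(i := a)) = val M \<phi> (w(i := a))" for a
    by (rule InfQ.IH) (use InfQ.prems in auto)
  then show ?case by (simp only: val.simps)
qed simp

text \<open>
  \<open>formula_in k \<phi>\<close>: \<open>\<phi>\<close> is a formula in the variables \<open>x\<^sub>0, \<dots>, x\<^sub>k\<^sub>-\<^sub>1\<close>. Tuples are lists, and
  \<open>value_at M \<phi> xs\<close> is the value of such a formula at a tuple \<open>xs\<close> of length \<open>k\<close>.
\<close>

definition formula_in :: "nat \<Rightarrow> form \<Rightarrow> bool" where
  "formula_in k \<phi> \<longleftrightarrow> wff \<phi> \<and> fv \<phi> \<subseteq> {..<k}"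

definition value_at :: "'a metric \<Rightarrow> form \<Rightarrow> 'a list \<Rightarrow> real" where
  "value_at M \<phi> xs = val M \<phi> (\<lambda>i. xs ! i)"

definition tuple_of :: "'a metric \<Rightarrow> nat \<Rightarrow> 'a list \<Rightarrow> bool" where
  "tuple_of M n xs \<longleftrightarrow> length xs = n \<and> set xs \<subseteq> mspace M"

definition diam_le_1 :: "'a metric \<Rightarrow> bool" where
  "diam_le_1 M \<longleftrightarrow> (\<forall>x\<in>mspace M. \<forall>y\<in>mspace M. mdist M x y \<le> 1)"

definition metric_structure :: "'a metric \<Rightarrow> bool" where
  "metric_structure M \<longleftrightarrow> mspace M \<noteq> {} \<and> mcomplete_of M \<and> diam_le_1 M"

text \<open>
  Types and theories are sets of conditions \<open>\<phi> = 0\<close>, each represented by \<open>\<phi>\<close>. The complete type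
  determines the value of every formula, because the truncated differences between a formula and
  a constant are again formulas.
\<close>

definition tp :: "'a metric \<Rightarrow> 'a list \<Rightarrow> form set" where
  "tp M xs = {\<phi>. formula_in (length xs) \<phi> \<and> value_at M \<phi> xs = 0}"

definition realizes :: "'a metric \<Rightarrow> 'a list \<Rightarrow> form set \<Rightarrow> bool" where
  "realizes M xs p \<longleftrightarrow> set xs \<subseteq> mspace M \<and> (\<forall>\<phi>\<in>p. value_at M \<phi> xs = 0)"

definition Th :: "'a metric \<Rightarrow> form set" where
  "Th M = tp M []"

definition model_of :: "'a metric \<Rightarrow> form set \<Rightarrow> bool" where
  "model_of M T \<longleftrightarrow> metric_structure M \<and> realizes M [] T"

text \<open>
  A condition with parameters from \<open>A\<close>, in the variables \<open>x\<^sub>0, \<dots>, x\<^sub>k\<^sub>-\<^sub>1\<close>, is a pair of a formula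
  and a list of parameters that is substituted for the variables \<open>x\<^sub>k, x\<^sub>k\<^sub>+\<^sub>1, \<dots>\<close>.
\<close>

definition conditions_over :: "'a set \<Rightarrow> nat \<Rightarrow> (form \<times> 'a list) set" where
  "conditions_over A k = {(\<phi>, as). set as \<subseteq> A \<and> formula_in (k + length as) \<phi>}"

definition satisfied_in :: "'a metric \<Rightarrow> nat \<Rightarrow> (form \<times> 'a list) set \<Rightarrow> bool" where
  "satisfied_in M k \<Gamma> \<longleftrightarrow>
     (\<exists>xs. tuple_of M k xs \<and> (\<forall>(\<phi>, as)\<in>\<Gamma>. value_at M \<phi> (xs @ as) = 0))"

unbundle cardinal_syntax

definition saturated :: "'k rel \<Rightarrow> 'a metric \<Rightarrow> bool" where
  "saturated \<kappa> M \<longleftrightarrow>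
     (\<forall>A k \<Gamma>. A \<subseteq> mspace M \<and> |A| <o \<kappa> \<and> \<Gamma> \<subseteq> conditions_over A k \<and>
        (\<forall>\<Gamma>\<^sub>0. finite \<Gamma>\<^sub>0 \<and> \<Gamma>\<^sub>0 \<subseteq> \<Gamma> \<longrightarrow> satisfied_in M k \<Gamma>\<^sub>0) \<longrightarrow> satisfied_in M k \<Gamma>)"

text \<open>
  ``Sufficiently saturated'' is read as \<open>\<kappa>\<close>-saturated for an arbitrary uncountable cardinal \<open>\<kappa>\<close>.
  Strong homogeneity is not demanded.
\<close>

definition monster_model :: "'k rel \<Rightarrow> form set \<Rightarrow> 'a metric \<Rightarrow> bool" where
  "monster_model \<kappa> T M \<longleftrightarrow> Card_order \<kappa> \<and> natLeq <o \<kappa> \<and> model_of M T \<and> saturated \<kappa> M"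

section \<open>The Urysohn sphere\<close>

definition isometry_into :: "'a set \<Rightarrow> 'a metric \<Rightarrow> 'b metric \<Rightarrow> ('a \<Rightarrow> 'b) \<Rightarrow> bool" where
  "isometry_into X M N f \<longleftrightarrow>
     f ` X \<subseteq> mspace N \<and> (\<forall>x\<in>X. \<forall>y\<in>X. mdist N (f x) (f y) = mdist M x y)"

definition ultrahomogeneous :: "'a metric \<Rightarrow> bool" where
  "ultrahomogeneous M \<longleftrightarrow>
     (\<forall>X f. finite X \<and> X \<subseteq> mspace M \<and> isometry_into X M M f \<longrightarrow>
        (\<exists>g. isometry_into (mspace M) M M g \<and> g ` mspace M = mspace M \<and> (\<forall>x\<in>X. g x = f x)))"

text \<open>
  A separable metric space has at most continuum many points, so up to isometry all of them occur
  among the metrics whose carrier is a set of real numbers.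
\<close>

definition universal_separable :: "'a metric \<Rightarrow> bool" where
  "universal_separable M \<longleftrightarrow>
     (\<forall>N :: real metric. separable_space (mtopology_of N) \<and> diam_le_1 N \<longrightarrow>
        (\<exists>f. isometry_into (mspace N) N M f))"

definition urysohn_sphere :: "'a metric \<Rightarrow> bool" where
  "urysohn_sphere M \<longleftrightarrow>
     mcomplete_of M \<and> separable_space (mtopology_of M) \<and>
     diam_le_1 M \<and> (SUP (x, y)\<in>mspace M \<times> mspace M. mdist M x y) = 1 \<and>
     ultrahomogeneous M \<and> universal_separable M"

section \<open>Indiscernible and cyclic sequences\<close>

definition indiscernible :: "'a metric \<Rightarrow> nat \<Rightarrow> (nat \<Rightarrow> 'a list) \<Rightarrow> bool" where
  "indiscernible M n a \<longleftrightarrow>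
     (\<forall>l. tuple_of M n (a l)) \<and>
     (\<forall>m \<phi> ls ks. formula_in (m * n) \<phi> \<and>
        length ls = m \<and> sorted_wrt (<) ls \<and> length ks = m \<and> sorted_wrt (<) ks \<longrightarrow>
        value_at M \<phi> (concat (map a ls)) = value_at M \<phi> (concat (map a ks)))"

text \<open>
  The tuples \<open>b 0, \<dots>, b (m - 1)\<close> interpret the variables of the cyclic union of copies of the type.
  Satisfiability is satisfiability in \<open>M\<close>, which for a monster model agrees with satisfiability in
  some model of its theory.
\<close>

definition cyclic :: "'a metric \<Rightarrow> nat \<Rightarrow> nat \<Rightarrow> (nat \<Rightarrow> 'a list) \<Rightarrow> bool" where
  "cyclic M n m a \<longleftrightarrow>
     (\<exists>b. (\<forall>i<m. tuple_of M n (b i)) \<and>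
          (\<forall>i<m. realizes M (b i @ b (Suc i mod m)) (tp M (a 0 @ a 1))))"

end

theory Submission
  imports Defs
begin

text \<open>
  In a monster model every one-point extension of a finite subset is realized, by saturation, so the
  finite partial isometries form a back-and-forth system and the type of a tuple is determined by its
  distances. Both parts thereby become statements about pseudometrics on families of \<open>n\<close>-tuples.

  For (a), extend the distances of the indiscernible sequence, which depend only on the displacement
  between positions, to walks around a cycle of \<open>n + 1\<close> tuples. A walk of displacement at least \<open>n\<close>
  visits some index \<open>k < n\<close> at two different positions; as the distance between two distinct
  occurrences of \<open>k\<close> does not depend on their order, the walk may jump to any position there, hence it
  is no shortcut for any prescribed distance. So the path pseudometric of the cycle realizes the type.

  For (b), use a path metric on \<open>\<nat> \<times> {0..<n}\<close> with edges of length \<open>1 / n\<close> between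
  \<open>(p, i)\<close> and \<open>(q, i + 1)\<close> for \<open>p < q\<close>: around a cycle of \<open>n\<close> tuples, \<open>n - 1\<close> such edges would
  bridge a distance that has to be \<open>1\<close>.
\<close>

section \<open>One-point extensions\<close>

text \<open>These \<open>f\<close> are the Katetov functions bounded by 1, the distances that a
  further point may have to the points of \<open>A\<close>. Nonnegativity is the case
  \<open>a = b\<close> of the last inequality; the value 0 is allowed.\<close>

definition ext_property :: "'a metric \<Rightarrow> bool" where
  "ext_property M \<longleftrightarrow>
     (\<forall>A f. finite A \<and> A \<subseteq> mspace M \<and> (\<forall>a\<in>A. f a \<le> 1) \<and>
        (\<forall>a\<in>A. \<forall>b\<in>A. f a \<le> f b + mdist M a b \<and> mdist M a b \<le> f a + f b) \<longrightarrow>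
        (\<exists>y\<in>mspace M. \<forall>a\<in>A. mdist M y a = f a))"

lemma mdist_self [simp]: "x \<in> mspace M \<Longrightarrow> mdist M x x = 0"
  by simp

text \<open>Points may repeat in the family: if \<open>x i = x j\<close>, the Lipschitz condition in
  both directions gives \<open>f i = f j\<close>, so \<open>f\<close> descends to a function of the
  points.\<close>

lemma ext_property_indexed:
  assumes ext: "ext_property M" and "finite I"
    and x: "\<And>i. i \<in> I \<Longrightarrow> x i \<in> mspace M"
    and f1: "\<And>i. i \<in> I \<Longrightarrow> f i \<le> 1"
    and f2: "\<And>i j. i \<in> I \<Longrightarrow> j \<in> I \<Longrightarrow> f i \<le> f j + mdist M (x i) (x j)"
    and f3: "\<And>i j. i \<in> I \<Longrightarrow> j \<in> I \<Longrightarrow> mdist M (x i) (x j) \<le> f i + f j"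
  obtains y where "y \<in> mspace M" "\<And>i. i \<in> I \<Longrightarrow> mdist M y (x i) = f i"
proof -
  define g where "g a = f (inv_into I x a)" for a
  have g: "g (x i) = f i" if "i \<in> I" for i
  proof -
    let ?j = "inv_into I x (x i)"
    have "?j \<in> I" "x ?j = x i"
      using that by (auto simp: inv_into_into f_inv_into_f)
    then show ?thesis
      using f2[of i ?j] f2[of ?j i] that x unfolding g_def by force
  qed
  have "\<exists>y\<in>mspace M. \<forall>a\<in>x ` I. mdist M y a = g a"
    using ext[unfolded ext_property_def, rule_format, of "x ` I" g] assms(2) x f1 f2 f3
    by (auto simp: g)
  then show thesis
    using that g by auto
qed

section \<open>One-point extensions in the Urysohn sphere\<close>

lemma separable_space_countable:
  assumes "countable (mspace N)"
  shows "separable_space (mtopology_of N)"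
  unfolding separable_space_def
  by (intro exI[of _ "mspace N"] conjI)
     (use assms closure_of_topspace[of "mtopology_of N"] in simp_all)

lemma urysohn_nonempty:
  assumes "urysohn_sphere U"
  shows "mspace U \<noteq> {}"
proof -
  have ms: "Metric_space {0::real} dist"
    by unfold_locales (auto simp: dist_commute dist_triangle)
  define N where "N = metric ({0::real}, dist)"
  have N: "mspace N = {0}" "mdist N = dist"
    using ms by (simp_all add: N_def Metric_space.mspace_metric Metric_space.mdist_metric)
  have "separable_space (mtopology_of N)" "diam_le_1 N"
    by (auto intro!: separable_space_countable simp: diam_le_1_def N)
  then obtain f where "isometry_into (mspace N) N U f"
    using assms unfolding urysohn_sphere_def universal_separable_def by blast
  then show ?thesis
    using N by (auto simp: isometry_into_def)
qed

text \<open>The extension of \<open>A\<close> by one point at distances \<open>f\<close> is a finite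
  metric space, so universality embeds it. Ultrahomogeneity then moves the copy of \<open>A\<close>
  back onto \<open>A\<close> and takes the new point along. If \<open>f\<close> vanishes at some
  point of \<open>A\<close>, that point already serves.\<close>

lemma urysohn_ext_property:
  assumes U: "urysohn_sphere U"
  shows "ext_property U"
  unfolding ext_property_def
proof (intro allI impI, elim conjE)
  fix A f
  assume fin: "finite A" and sub: "A \<subseteq> mspace U" and f1: "\<forall>a\<in>A. f a \<le> (1::real)"
    and f2: "\<forall>a\<in>A. \<forall>b\<in>A. f a \<le> f b + mdist U a b \<and> mdist U a b \<le> f a + f b"
  have f0: "f a \<ge> 0" if "a \<in> A" for a
    using f2[rule_format, OF that that] sub that by auto
  show "\<exists>y\<in>mspace U. \<forall>a\<in>A. mdist U y a = f a"
  proof (cases "\<exists>a\<in>A. f a = 0")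
    case True
    then obtain a where a: "a \<in> A" "f a = 0" by blast
    have "mdist U a b = f b" if "b \<in> A" for b
      using f2 a that by (smt (verit) mdist_commute)
    then show ?thesis using a sub by blast
  next
    case False
    then have pos: "f a > 0" if "a \<in> A" for a
      using f0[OF that] that by force
    \<comment> \<open>Universality concerns metrics on sets of reals, so \<open>A\<close> is coded
      by natural numbers and the new point by -1.\<close>
    obtain h :: "'a \<Rightarrow> nat" where h: "inj_on h A"
      using finite_imp_inj_to_nat_seg[OF fin] by blast
    define e where "e a = real (h a)" for a
    have inj: "inj_on e A" using h by (auto simp: e_def inj_on_def)
    define c where "c = inv_into A e"
    have ce [simp]: "c (e a) = a" if "a \<in> A" for a
      using inj that by (simp add: c_def)
    have e_new [simp]: "e a \<noteq> - 1" "- 1 \<noteq> e a" for a unfolding e_def by linarith+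
    have e_eq [simp]: "e a = e b \<longleftrightarrow> a = b" if "a \<in> A" "b \<in> A" for a b
      using inj that by (auto dest: inj_onD)
    have abs_f [simp]: "\<bar>f a\<bar> = f a" if "a \<in> A" for a
      using f0[OF that] by simp
    \<comment> \<open>The absolute values keep \<open>dN\<close> nonnegative off the carrier too,
      where \<open>Metric_space\<close> demands it.\<close>
    define dN where "dN s t = (if s = t then 0 else if s = - 1 then \<bar>f (c t)\<bar>
       else if t = - 1 then \<bar>f (c s)\<bar> else mdist U (c s) (c t))" for s t :: real
    define C where "C = insert (- 1) (e ` A)"
    have ms: "Metric_space C dN"
    proof
      show "0 \<le> dN x y" "dN x y = dN y x" for x y
        by (auto simp: dN_def mdist_commute)
      show "(dN x y = 0) = (x = y)" if xy: "x \<in> C" "y \<in> C" for x y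
      proof -
        consider "x = y" | a b where "x = e a" "y = e b" "a \<in> A" "b \<in> A" "a \<noteq> b"
          | b where "x = - 1" "y = e b" "b \<in> A" | a where "x = e a" "y = - 1" "a \<in> A"
          using xy unfolding C_def by blast
        then show ?thesis
        proof cases
          case 2
          have "mdist U a b \<noteq> 0" using 2 sub mdist_zero[of a U b] by blast
          then show ?thesis using 2 by (simp add: dN_def)
        next
          case 3
          then show ?thesis using pos[of b] by (simp add: dN_def)
        next
          case 4
          then show ?thesis using pos[of a] by (simp add: dN_def)
        qed (simp add: dN_def)
      qed
      show "dN x z \<le> dN x y + dN y z" if xyz: "x \<in> C" "y \<in> C" "z \<in> C" for x y z
      proof -
        have tr: "mdist U a b \<le> mdist U a k + mdist U k b" if "a \<in> A" "b \<in> A" "k \<in> A" for a b k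
          using sub that by (intro mdist_triangle) auto
        consider "x = y \<or> y = z \<or> x = z"
          | a b k where "x = e a" "y = e b" "z = e k" "a \<in> A" "b \<in> A" "k \<in> A"
          | b k where "x = - 1" "y = e b" "z = e k" "b \<in> A" "k \<in> A"
          | a k where "x = e a" "y = - 1" "z = e k" "a \<in> A" "k \<in> A"
          | a b where "x = e a" "y = e b" "z = - 1" "a \<in> A" "b \<in> A"
          using xyz unfolding C_def by blast
        then show ?thesis
        proof cases
          case 1
          then show ?thesis by (auto simp: dN_def)
        next
          case 2
          then show ?thesis using tr[of a k b] by (cases "a = b"; cases "b = k") (simp_all add: dN_def)
        next
          case 3
          then show ?thesis using f2[rule_format, of k b]
            by (cases "b = k") (simp_all add: dN_def mdist_commute[of U k b])
        next
          case 4
          then show ?thesis using f2[rule_format, of a k] f0[of a] by (cases "a = k") (simp_all add: dN_def)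
        next
          case 5
          then show ?thesis using f2[rule_format, of a b] by (cases "a = b") (simp_all add: dN_def)
        qed
      qed
    qed
    define N where "N = metric (C, dN)"
    have N: "mspace N = C" "mdist N = dN"
      using ms by (simp_all add: N_def Metric_space.mspace_metric Metric_space.mdist_metric)
    have "separable_space (mtopology_of N)"
      using fin by (intro separable_space_countable) (simp add: N C_def countable_finite)
    moreover have "diam_le_1 N"
      unfolding diam_le_1_def N
    proof (intro ballI)
      fix s t assume st: "s \<in> C" "t \<in> C"
      have "mdist U a b \<le> 1" if "a \<in> A" "b \<in> A" for a b
        using U sub that unfolding urysohn_sphere_def diam_le_1_def by blast
      then show "dN s t \<le> 1"
        using st f1 by (auto simp: C_def dN_def)
    qed
    ultimately obtain F where F: "isometry_into (mspace N) N U F"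
      using U unfolding urysohn_sphere_def universal_separable_def by blast
    have Fin: "F s \<in> mspace U" if "s \<in> C" for s
      using F that by (auto simp: isometry_into_def N)
    have Fd: "mdist U (F s) (F t) = dN s t" if "s \<in> C" "t \<in> C" for s t
      using F that by (auto simp: isometry_into_def N)
    define E where "E a = F (e a)" for a
    have eC: "e a \<in> C" if "a \<in> A" for a using that by (simp add: C_def)
    have Ed: "mdist U (E a) (E b) = mdist U a b" if "a \<in> A" "b \<in> A" for a b
      using Fd[OF eC eC, OF that] that sub inj by (auto simp: E_def dN_def inj_on_def)
    have injE: "inj_on E A"
    proof (rule inj_onI)
      fix a b assume ab: "a \<in> A" "b \<in> A" "E a = E b"
      then have "mdist U a b = 0" using Ed[of a b] Fin[OF eC] by (simp add: E_def)
      then show "a = b" using ab sub mdist_zero[of a U b] by blast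
    qed
    \<comment> \<open>The inverse of the embedding is a partial isometry from the copy of
      \<open>A\<close> onto \<open>A\<close>; its global extension \<open>g\<close> sends
      \<open>F (- 1)\<close> to the required point.\<close>
    have "isometry_into (E ` A) U U (inv_into A E)"
      using injE Ed sub by (auto simp: isometry_into_def)
    moreover have "finite (E ` A)" "E ` A \<subseteq> mspace U"
      using fin Fin eC by (auto simp: E_def)
    moreover have "ultrahomogeneous U" using U by (simp add: urysohn_sphere_def)
    ultimately obtain g where g: "isometry_into (mspace U) U U g"
      "\<forall>x\<in>E ` A. g x = inv_into A E x"
      unfolding ultrahomogeneous_def by (metis (no_types))
    have new: "- 1 \<in> C" by (simp add: C_def)
    have "mdist U (g (F (- 1))) a = f a" if "a \<in> A" for a
    proof -
      have "mdist U (g (F (- 1))) (g (E a)) = mdist U (F (- 1)) (E a)"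
        using g(1) Fin[OF new] Fin[OF eC[OF that]] by (auto simp: isometry_into_def E_def)
      also have "\<dots> = f a"
        unfolding E_def using Fd[OF new eC[OF that]] that f0 by (simp add: dN_def)
      finally show ?thesis using g(2) that injE by simp
    qed
    moreover have "g (F (- 1)) \<in> mspace U"
      using g(1) Fin[OF new] by (auto simp: isometry_into_def)
    ultimately show ?thesis by blast
  qed
qed

text \<open>A stable form of the extension property: \<open>f\<close> is Katetov for the matrix
  \<open>D\<close>, from which the actual distances differ by at most \<open>\<delta>\<close>. A
  correction of order \<open>\<delta>\<close> turns \<open>f\<close> into a Katetov function for the
  actual distances.\<close>

lemma ext_property_perturbed:
  fixes k :: nat
  assumes ext: "ext_property U"
    and w: "\<And>i. i < k \<Longrightarrow> w i \<in> mspace U"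
    and diam: "diam_le_1 U"
    and f0: "\<And>i. i < k \<Longrightarrow> 0 \<le> f i" and f1: "\<And>i. i < k \<Longrightarrow> f i \<le> 1"
    and f2: "\<And>i j. i < k \<Longrightarrow> j < k \<Longrightarrow> f i \<le> f j + D i j"
    and f3: "\<And>i j. i < k \<Longrightarrow> j < k \<Longrightarrow> D i j \<le> f i + f j"
    and \<delta>: "\<And>i j. i < k \<Longrightarrow> j < k \<Longrightarrow> \<bar>mdist U (w i) (w j) - D i j\<bar> \<le> \<delta>"
  obtains y where "y \<in> mspace U" "\<And>i. i < k \<Longrightarrow> \<bar>mdist U y (w i) - f i\<bar> \<le> 2 * \<delta>"
proof -
  \<comment> \<open>The largest 1-Lipschitz function below \<open>f\<close> for the actual
    distances; it loses at most \<open>\<delta>\<close>.\<close>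
  define g where "g i = Min ((\<lambda>j. f j + mdist U (w i) (w j)) ` {..<k})" for i
  have g_le: "g i \<le> f j + mdist U (w i) (w j)" if "j < k" for i j
    unfolding g_def using that by (intro Min_le finite_imageI) auto
  have g_eq: "\<exists>j<k. g i = f j + mdist U (w i) (w j)" if "i < k" for i
  proof -
    have "g i \<in> (\<lambda>j. f j + mdist U (w i) (w j)) ` {..<k}"
      unfolding g_def using that by (intro Min_in) auto
    then show ?thesis by auto
  qed
  have tr: "mdist U (w i) (w j) \<le> mdist U (w i) (w l) + mdist U (w l) (w j)"
    if "i < k" "j < k" "l < k" for i j l
    using w that by (intro mdist_triangle) auto
  have d1: "mdist U (w i) (w j) \<le> 1" if "i < k" "j < k" for i j
    using diam w that by (auto simp: diam_le_1_def)
  have g_up: "g i \<le> f i" if "i < k" for i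
    using g_le[OF that, of i] w[OF that] by simp
  have g_lo: "f i - \<delta> \<le> g i" if "i < k" for i
    using g_eq[OF that] f2 \<delta> that by (smt (verit))
  have g_lip: "g i \<le> g j + mdist U (w i) (w j)" if "i < k" "j < k" for i j
    using g_eq[OF that(2)] g_le[of _ i] tr that by (smt (verit))
  have g_sum: "mdist U (w i) (w j) \<le> g i + g j + 3 * \<delta>" if "i < k" "j < k" for i j
    using g_lo[OF that(1)] g_lo[OF that(2)] f3[OF that] \<delta>[OF that] by linarith
  have \<delta>0: "\<delta> \<ge> 0" if "i < k" for i
    using \<delta>[OF that that] by linarith
  \<comment> \<open>By \<open>g_sum\<close>, a sum of two values falls short by at most
    \<open>3 * \<delta>\<close>, so each is raised by half of that. Truncation at 1 does no harm
    because the diameter is at most 1.\<close>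
  define f' where "f' i = min 1 (g i + 3 / 2 * \<delta>)" for i
  have close: "\<bar>f' i - f i\<bar> \<le> 2 * \<delta>" if "i < k" for i
    using g_up[OF that] g_lo[OF that] \<delta>0[OF that] f1[OF that] unfolding f'_def by linarith
  have nonneg: "0 \<le> g i + 3 / 2 * \<delta>" if "i < k" for i
    using g_lo[OF that] \<delta>0[OF that] f0[OF that] by linarith
  obtain y where "y \<in> mspace U" "\<And>i. i \<in> {..<k} \<Longrightarrow> mdist U y (w i) = f' i"
  proof (rule ext_property_indexed[OF ext, of "{..<k}" w f'])
    fix i j assume "i \<in> {..<k}" "j \<in> {..<k}"
    then have ij: "i < k" "j < k" by auto
    show "f' i \<le> f' j + mdist U (w i) (w j)"
      using g_lip[OF ij] mdist_nonneg[of U "w i" "w j"] unfolding f'_def by linarith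
    show "mdist U (w i) (w j) \<le> f' i + f' j"
      using g_sum[OF ij] d1[OF ij] nonneg[OF ij(1)] nonneg[OF ij(2)] unfolding f'_def by linarith
  qed (auto simp: w f'_def)
  then show thesis using that close by auto
qed

section \<open>Saturation and quantifier elimination\<close>

lemma connective_bounds:
  assumes "connective (length ys) u" "set ys \<subseteq> {0..1}"
  shows "u ys \<in> {0..1}"
proof -
  \<comment> \<open>Points of the product topology are extensional functions, hence the
    restriction.\<close>
  let ?x = "restrict ((!) ys) {..<length ys}"
  have "ys ! i \<in> {0..1}" if "i < length ys" for i
    using assms(2) nth_mem[OF that] by blast
  then have "?x \<in> topspace (product_topology (\<lambda>_. top_of_set {0..1::real}) {..<length ys})"
    by simp
  moreover have "(\<lambda>x. u (map x [0..<length ys])) \<in>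
      topspace (product_topology (\<lambda>_. top_of_set {0..1::real}) {..<length ys}) \<rightarrow> {0..1}"
    using continuous_map_funspace[OF assms(1)[unfolded connective_def]] by simp
  ultimately have "u (map ?x [0..<length ys]) \<in> {0..1}"
    by (rule funcset_mem[rotated])
  moreover have "map ?x [0..<length ys] = ys"
    by (rule nth_equalityI) auto
  ultimately show ?thesis by simp
qed

lemma val_bounds:
  assumes M: "mspace M \<noteq> {}" "diam_le_1 M"
  shows "wff \<phi> \<Longrightarrow> (\<And>i. i \<in> fv \<phi> \<Longrightarrow> v i \<in> mspace M) \<Longrightarrow> val M \<phi> v \<in> {0..1}"
proof (induction \<phi> arbitrary: v)
  case (Dist i j)
  then show ?case using M by (auto simp: diam_le_1_def)
next
  case (Conn u \<phi>s)
  have "val M \<phi> v \<in> {0..1}" if "\<phi> \<in> set \<phi>s" for \<phi>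
    using Conn that by auto
  then have "set (map (\<lambda>\<phi>. val M \<phi> v) \<phi>s) \<subseteq> {0..1}" by auto
  then show ?case
    using connective_bounds[of "map (\<lambda>\<phi>. val M \<phi> v) \<phi>s" u] Conn.prems by simp
next
  case (SupQ i \<phi>)
  have b: "val M \<phi> (v(i := a)) \<in> {0..1}" if "a \<in> mspace M" for a
    using SupQ that by auto
  obtain a where a: "a \<in> mspace M" using M by blast
  have "bdd_above ((\<lambda>a. val M \<phi> (v(i := a))) ` mspace M)"
    using b by (auto intro!: bdd_aboveI[of _ 1])
  then have "0 \<le> val M (SupQ i \<phi>) v"
    using cSUP_upper2[OF _ a] b[OF a] by auto
  moreover have "val M (SupQ i \<phi>) v \<le> 1"
    using b M by (auto intro!: cSUP_least)
  ultimately show ?case by simp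
next
  case (InfQ i \<phi>)
  have b: "val M \<phi> (v(i := a)) \<in> {0..1}" if "a \<in> mspace M" for a
    using InfQ that by auto
  obtain a where a: "a \<in> mspace M" using M by blast
  have "bdd_below ((\<lambda>a. val M \<phi> (v(i := a))) ` mspace M)"
    using b by (auto intro!: bdd_belowI[of _ 0])
  then have "val M (InfQ i \<phi>) v \<le> 1"
    using cINF_lower2[OF _ a] b[OF a] by auto
  moreover have "0 \<le> val M (InfQ i \<phi>) v"
    using b M by (auto intro!: cINF_greatest)
  ultimately show ?case by simp
qed

text \<open>Values are nonnegative, so a supremum is 0 exactly if all values are: on conditions,
  \<open>SupQ\<close> acts as the universal quantifier.\<close>

lemma val_SupQ_eq_0_iff:
  assumes M: "mspace M \<noteq> {}" "diam_le_1 M"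
    and "wff \<phi>" "\<And>j. j \<in> fv \<phi> - {i} \<Longrightarrow> v j \<in> mspace M"
  shows "val M (SupQ i \<phi>) v = 0 \<longleftrightarrow> (\<forall>a\<in>mspace M. val M \<phi> (v(i := a)) = 0)"
proof
  have b: "val M \<phi> (v(i := a)) \<in> {0..1}" if "a \<in> mspace M" for a
    using assms that by (intro val_bounds) auto
  assume "val M (SupQ i \<phi>) v = 0"
  moreover have "bdd_above ((\<lambda>a. val M \<phi> (v(i := a))) ` mspace M)"
    using b by (auto intro!: bdd_aboveI[of _ 1])
  ultimately have "val M \<phi> (v(i := a)) \<le> 0" if "a \<in> mspace M" for a
    using cSUP_upper[OF that, of "\<lambda>a. val M \<phi> (v(i := a))"] by simp
  then show "\<forall>a\<in>mspace M. val M \<phi> (v(i := a)) = 0"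
    using b by (auto intro: antisym)
qed (use M in simp)

text \<open>For conditions this is the universal closure over the variables below \<open>k\<close>,
  with variable 0 outermost.\<close>

primrec sups :: "nat \<Rightarrow> form \<Rightarrow> form" where
  "sups 0 \<phi> = \<phi>"
| "sups (Suc k) \<phi> = sups k (SupQ k \<phi>)"

lemma wff_sups [simp]: "wff (sups k \<phi>) = wff \<phi>"
  by (induction k arbitrary: \<phi>) auto

lemma fv_sups [simp]: "fv (sups k \<phi>) = fv \<phi> - {..<k}"
  by (induction k arbitrary: \<phi>) (auto simp: less_Suc_eq)

lemma val_sups_eq_0_iff:
  assumes M: "mspace M \<noteq> {}" "diam_le_1 M"
  shows "wff \<phi> \<Longrightarrow> (\<And>i. i \<in> fv \<phi> \<Longrightarrow> k \<le> i \<Longrightarrow> v i \<in> mspace M) \<Longrightarrow>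
    val M (sups k \<phi>) v = 0 \<longleftrightarrow>
    (\<forall>w. (\<forall>i<k. w i \<in> mspace M) \<longrightarrow> (\<forall>i\<ge>k. w i = v i) \<longrightarrow> val M \<phi> w = 0)"
proof (induction k arbitrary: \<phi>)
  case 0
  have "w = v" if "\<forall>i. w i = v i" for w using that by auto
  then show ?case by auto
next
  case (Suc k)
  have "val M (sups (Suc k) \<phi>) v = 0 \<longleftrightarrow>
      (\<forall>w. (\<forall>i<k. w i \<in> mspace M) \<longrightarrow> (\<forall>i\<ge>k. w i = v i) \<longrightarrow> val M (SupQ k \<phi>) w = 0)"
    using Suc.prems Suc.IH[of "SupQ k \<phi>"] by (force simp del: val.simps)
  also have "\<dots> \<longleftrightarrow> (\<forall>w. (\<forall>i<k. w i \<in> mspace M) \<longrightarrow> (\<forall>i\<ge>k. w i = v i) \<longrightarrow>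
      (\<forall>a\<in>mspace M. val M \<phi> (w(k := a)) = 0))"
  proof (intro all_cong1 imp_cong refl)
    fix w assume w: "\<forall>i<k. w i \<in> mspace M" "\<forall>i\<ge>k. w i = v i"
    have "w j \<in> mspace M" if "j \<in> fv \<phi> - {k}" for j
      using w Suc.prems(2)[of j] that by (cases "j < k") auto
    then show "val M (SupQ k \<phi>) w = 0 \<longleftrightarrow> (\<forall>a\<in>mspace M. val M \<phi> (w(k := a)) = 0)"
      using Suc.prems(1) by (intro val_SupQ_eq_0_iff[OF M]) auto
  qed
  also have "\<dots> \<longleftrightarrow> (\<forall>w. (\<forall>i<Suc k. w i \<in> mspace M) \<longrightarrow> (\<forall>i\<ge>Suc k. w i = v i) \<longrightarrow> val M \<phi> w = 0)"
    (is "?L \<longleftrightarrow> ?R")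
  proof
    assume L: ?L
    show ?R
    proof (intro allI impI)
      fix w assume w: "\<forall>i<Suc k. w i \<in> mspace M" "\<forall>i\<ge>Suc k. w i = v i"
      \<comment> \<open>\<open>L\<close> asks for agreement with \<open>v\<close> at
        \<open>k\<close> as well, so that entry is reset and \<open>w k\<close> is supplied by the
        quantifier.\<close>
      then have "val M \<phi> ((w(k := v k))(k := w k)) = 0"
        using L[rule_format, of "w(k := v k)" "w k"] by auto
      then show "val M \<phi> w = 0" by simp
    qed
  next
    assume ?R
    then show ?L by (auto simp: less_Suc_eq Suc_le_eq)
  qed
  finally show ?case .
qed

text \<open>The sentence "for all earlier variables, the infimum over variable \<open>k\<close> of
  \<open>\<psi>\<close> is 0" holds in \<open>U\<close>, hence in \<open>M\<close>. An infimum need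
  not be attained, so \<open>M\<close> has only approximate witnesses.\<close>

lemma Th_transfer:
  assumes U: "mspace U \<noteq> {}" "diam_le_1 U" and M: "mspace M \<noteq> {}" "diam_le_1 M"
    and real: "realizes M [] (Th U)"
    and \<psi>: "wff \<psi>" "fv \<psi> \<subseteq> {..k}"
    and solve: "\<And>w. (\<And>i. i < k \<Longrightarrow> w i \<in> mspace U) \<Longrightarrow> \<exists>y\<in>mspace U. val U \<psi> (w(k := y)) = 0"
    and x: "\<And>i. i < k \<Longrightarrow> x i \<in> mspace M" and "\<epsilon> > 0"
  shows "\<exists>y\<in>mspace M. val M \<psi> (x(k := y)) < \<epsilon>"
proof -
  define \<phi> where "\<phi> = sups k (InfQ k \<psi>)"
  have \<psi>k: "i < k" if "i \<in> fv \<psi>" "i \<noteq> k" for i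
    using that \<psi>(2) by (auto simp: le_less)
  have \<phi>: "wff \<phi>" "fv \<phi> = {}"
    using \<psi> \<psi>k by (auto simp: \<phi>_def)
  have "val U (InfQ k \<psi>) w = 0" if w: "\<forall>i<k. w i \<in> mspace U" for w
  proof (rule antisym)
    obtain y where y: "y \<in> mspace U" "val U \<psi> (w(k := y)) = 0"
      using solve w by blast
    have b: "0 \<le> val U \<psi> (w(k := a))" if "a \<in> mspace U" for a
      using val_bounds[OF U \<psi>(1), of "w(k := a)"] \<psi>k w that by force
    then have "bdd_below ((\<lambda>a. val U \<psi> (w(k := a))) ` mspace U)"
      by (auto intro!: bdd_belowI[of _ 0])
    from cINF_lower[OF this y(1)] show "val U (InfQ k \<psi>) w \<le> 0"
      using y(2) by simp
    show "0 \<le> val U (InfQ k \<psi>) w"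
      using b U by (auto intro!: cINF_greatest)
  qed
  then have "val U \<phi> ((!) []) = 0"
    unfolding \<phi>_def using \<psi> \<psi>k
    by (subst val_sups_eq_0_iff[OF U]) (auto simp del: val.simps)
  then have "\<phi> \<in> Th U"
    using \<phi> by (simp add: Th_def tp_def formula_in_def value_at_def)
  then have "val M \<phi> ((!) []) = 0"
    using real by (simp add: realizes_def value_at_def)
  then have "val M \<phi> x = 0"
    using \<phi> val_cong[of \<phi> "(!) []" x M] by simp
  then have "val M (InfQ k \<psi>) x = 0"
    unfolding \<phi>_def using \<psi> \<psi>k x
    by (subst (asm) val_sups_eq_0_iff[OF M]) (auto simp del: val.simps)
  then have "Inf ((\<lambda>y. val M \<psi> (x(k := y))) ` mspace M) < \<epsilon>"
    using \<open>\<epsilon> > 0\<close> by simp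
  from cInf_lessD[OF _ this] show ?thesis
    using M by blast
qed

section \<open>Approximate one-point extensions and saturation\<close>

text \<open>
  The entry \<open>(i, j, c, r)\<close> of a table contributes the summand \<open>c * \<bar>d(x\<^sub>i, x\<^sub>j) - r\<bar>\<close> to the formula
  \<open>dev_form\<close>, which truncates the total to the unit interval.
\<close>

definition dev :: "(nat \<times> nat \<times> real \<times> real) list \<Rightarrow> real list \<Rightarrow> real" where
  "dev T ws = max 0 (min 1 (\<Sum>t<length T. case T ! t of (i, j, c, r) \<Rightarrow> c * \<bar>ws ! t - r\<bar>))"

definition dev_form :: "(nat \<times> nat \<times> real \<times> real) list \<Rightarrow> form" where
  "dev_form T = Conn (dev T) (map (\<lambda>(i, j, c, r). Dist i j) T)"

lemma wff_dev_form [simp]: "wff (dev_form T)"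
proof -
  let ?X = "product_topology (\<lambda>_. top_of_set {0..1::real}) {..<length T}"
  have proj: "continuous_map ?X euclideanreal (\<lambda>x. x t)" if "t < length T" for t
    by (rule continuous_map_into_fulltopology, rule continuous_map_product_projection)
       (use that in simp)
  have "continuous_map ?X euclideanreal (\<lambda>x. case T ! t of (i, j, c, r) \<Rightarrow> c * \<bar>x t - r\<bar>)"
    if "t < length T" for t
    by (cases "T ! t") (auto intro!: continuous_map_real_mult continuous_map_real_abs
        continuous_map_diff proj that)
  then have "continuous_map ?X euclideanreal
      (\<lambda>x. max 0 (min 1 (\<Sum>t<length T. case T ! t of (i, j, c, r) \<Rightarrow> c * \<bar>x t - r\<bar>)))"
    by (intro continuous_map_real_max continuous_map_real_min continuous_map_sum)
       auto
  then have "continuous_map ?X euclideanreal (\<lambda>x. dev T (map x [0..<length T]))"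
    by (rule continuous_map_eq) (auto simp: dev_def)
  then have "connective (length T) (dev T)"
    unfolding connective_def by (intro continuous_map_into_subtopology) (auto simp: dev_def)
  then show ?thesis
    by (auto simp: dev_form_def)
qed

lemma fv_dev_form: "fv (dev_form T) = (\<Union>(i, j, c, r)\<in>set T. {i, j})"
  by (auto simp: dev_form_def)

lemma val_dev_form:
  "val M (dev_form T) v = max 0 (min 1 (\<Sum>(i, j, c, r)\<leftarrow>T. c * \<bar>mdist M (v i) (v j) - r\<bar>))"
proof -
  have "(\<Sum>t<length T. case T ! t of (i, j, c, r) \<Rightarrow>
        c * \<bar>map (\<lambda>\<phi>. val M \<phi> v) (map (\<lambda>(i, j, c, r). Dist i j) T) ! t - r\<bar>) =
      (\<Sum>(i, j, c, r)\<leftarrow>T. c * \<bar>mdist M (v i) (v j) - r\<bar>)"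
    unfolding sum_list_sum_nth
    by (intro sum.cong) (auto simp: atLeast0LessThan split: prod.split)
  then show ?thesis by (simp add: dev_form_def dev_def)
qed

text \<open>The formula \<open>\<psi>\<close> measures how far \<open>y\<close> is from realizing
  \<open>f\<close>, minus a multiple of how far the parameters are from having the distances
  \<open>D\<close>. The perturbed extension property makes it solvable over all parameters in
  \<open>U\<close>; at \<open>x\<close> in \<open>M\<close> the subtracted part vanishes.\<close>

lemma approximate_extension:
  fixes k :: nat
  assumes U: "mspace U \<noteq> {}" "diam_le_1 U" "ext_property U" and M: "mspace M \<noteq> {}" "diam_le_1 M"
    and real: "realizes M [] (Th U)"
    and x: "\<And>i. i < k \<Longrightarrow> x i \<in> mspace M"
    and f1: "\<And>i. i < k \<Longrightarrow> f i \<le> 1"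
    and f2: "\<And>i j. i < k \<Longrightarrow> j < k \<Longrightarrow> f i \<le> f j + mdist M (x i) (x j)"
    and f3: "\<And>i j. i < k \<Longrightarrow> j < k \<Longrightarrow> mdist M (x i) (x j) \<le> f i + f j"
    and "\<epsilon> > 0"
  shows "\<exists>y\<in>mspace M. \<forall>i<k. \<bar>mdist M y (x i) - f i\<bar> < \<epsilon>"
proof -
  define D where "D i j = mdist M (x i) (x j)" for i j
  \<comment> \<open>The weight \<open>2 * real k\<close> comes from \<open>k\<close> summands that
    are each at most twice the total deviation of the parameters.\<close>
  define T where "T = map (\<lambda>i. (k, i, 1, f i)) [0..<k] @
    map (\<lambda>(i, j). (i, j, - 2 * real k, D i j)) (List.product [0..<k] [0..<k])"
  define \<psi> where "\<psi> = dev_form T"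
  have f0: "0 \<le> f i" if "i < k" for i
    using f3[OF that that] x[OF that] by simp
  have val: "val N \<psi> (w(k := y)) = max 0 (min 1 ((\<Sum>i<k. \<bar>mdist N y (w i) - f i\<bar>) -
      2 * real k * (\<Sum>(i, j)\<in>{..<k} \<times> {..<k}. \<bar>mdist N (w i) (w j) - D i j\<bar>)))"
    for N :: "'c metric" and w y
  proof -
    have 1: "(\<Sum>i\<leftarrow>[0..<k]. \<bar>mdist N y (w i) - f i\<bar>) = (\<Sum>i<k. \<bar>mdist N y (w i) - f i\<bar>)"
      by (simp add: interv_sum_list_conv_sum_set_nat atLeast0LessThan)
    have 2: "(\<Sum>(i, j)\<leftarrow>List.product [0..<k] [0..<k]. - 2 * real k * \<bar>mdist N (w i) (w j) - D i j\<bar>) =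
        - 2 * real k * (\<Sum>(i, j)\<in>{..<k} \<times> {..<k}. \<bar>mdist N (w i) (w j) - D i j\<bar>)"
      by (subst sum_list_distinct_conv_sum_set)
         (auto simp: distinct_product atLeast0LessThan sum_distrib_left case_prod_beta)
    have "(\<Sum>(i, j, c, r)\<leftarrow>T. c * \<bar>mdist N ((w(k := y)) i) ((w(k := y)) j) - r\<bar>) =
        (\<Sum>i\<leftarrow>[0..<k]. \<bar>mdist N y (w i) - f i\<bar>) +
        (\<Sum>(i, j)\<leftarrow>List.product [0..<k] [0..<k]. - 2 * real k * \<bar>mdist N (w i) (w j) - D i j\<bar>)"
      unfolding T_def map_append sum_list_append map_map
      by (intro arg_cong2[of _ _ _ _ "(+)"] arg_cong[of _ _ sum_list] map_cong refl) auto
    then show ?thesis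
      unfolding \<psi>_def val_dev_form 1 2 by simp
  qed
  \<comment> \<open>A value below 1 rules out truncation from above, so the sum itself is below
    \<open>\<epsilon>\<close>.\<close>
  have "\<exists>y\<in>mspace M. val M \<psi> (x(k := y)) < min \<epsilon> 1"
  proof (rule Th_transfer[OF U(1,2) M real])
    show "wff \<psi>" "fv \<psi> \<subseteq> {..k}"
      by (auto simp: \<psi>_def fv_dev_form T_def)
    fix w assume w: "\<And>i. i < k \<Longrightarrow> w i \<in> mspace U"
    define \<delta> where "\<delta> = (\<Sum>(i, j)\<in>{..<k} \<times> {..<k}. \<bar>mdist U (w i) (w j) - D i j\<bar>)"
    have "\<bar>mdist U (w i) (w j) - D i j\<bar> \<le> \<delta>" if "i < k" "j < k" for i j
      unfolding \<delta>_def
      using member_le_sum[of "(i, j)" "{..<k} \<times> {..<k}" "\<lambda>(i, j). \<bar>mdist U (w i) (w j) - D i j\<bar>"] that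
      by auto
    then obtain y where y: "y \<in> mspace U" "\<And>i. i < k \<Longrightarrow> \<bar>mdist U y (w i) - f i\<bar> \<le> 2 * \<delta>"
      using ext_property_perturbed[OF U(3), of k w f D \<delta>] w U(2) f0 f1 f2 f3 by (auto simp: D_def)
    have "(\<Sum>i<k. \<bar>mdist U y (w i) - f i\<bar>) \<le> 2 * real k * \<delta>"
      using sum_bounded_above[of "{..<k}" "\<lambda>i. \<bar>mdist U y (w i) - f i\<bar>" "2 * \<delta>"] y(2) by simp
    then show "\<exists>y\<in>mspace U. val U \<psi> (w(k := y)) = 0"
      using y(1) by (intro bexI[of _ y]) (auto simp: val \<delta>_def[symmetric])
  qed (use x \<open>\<epsilon> > 0\<close> in auto)
  then obtain y where y: "y \<in> mspace M" "(\<Sum>i<k. \<bar>mdist M y (x i) - f i\<bar>) < \<epsilon>"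
    by (auto simp: val D_def)
  have "\<bar>mdist M y (x i) - f i\<bar> < \<epsilon>" if "i < k" for i
    using member_le_sum[of i "{..<k}" "\<lambda>i. \<bar>mdist M y (x i) - f i\<bar>"] that y(2) by auto
  then show ?thesis using y(1) by blast
qed

text \<open>The conditions \<open>\<bar>d(y, a) - f a\<bar> \<le> \<epsilon>\<close>, for
  \<open>a\<close> in \<open>A\<close> and \<open>\<epsilon> > 0\<close>, are finitely satisfiable
  by approximate extension. Saturation realizes all of them at once, and then the distances are
  exact.\<close>

lemma monster_ext_property:
  assumes U: "urysohn_sphere U" and M: "monster_model \<kappa> (Th U) M"
  shows "ext_property M"
  unfolding ext_property_def
proof (intro allI impI, elim conjE)
  fix A f
  assume fin: "finite A" and sub: "A \<subseteq> mspace M" and f1: "\<forall>a\<in>A. f a \<le> (1::real)"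
    and f2: "\<forall>a\<in>A. \<forall>b\<in>A. f a \<le> f b + mdist M a b \<and> mdist M a b \<le> f a + f b"
  have U': "mspace U \<noteq> {}" "diam_le_1 U" "ext_property U"
    using U urysohn_nonempty urysohn_ext_property by (auto simp: urysohn_sphere_def)
  have M': "mspace M \<noteq> {}" "diam_le_1 M" and real: "realizes M [] (Th U)"
    and sat: "saturated \<kappa> M" and \<kappa>: "natLeq <o \<kappa>"
    using M by (auto simp: monster_model_def model_of_def metric_structure_def)
  obtain xs where xs: "set xs = A" using finite_list[OF fin] by blast
  have nth: "xs ! i \<in> A" if "i < length xs" for i using that xs by auto
  \<comment> \<open>As \<open>d(x\<^sub>0, x\<^sub>0) = 0\<close>, the table entry \<open>(0, 0, - \<epsilon>, 1)\<close> subtracts the constant \<open>\<epsilon>\<close>.\<close>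
  define cond where "cond \<epsilon> i = (dev_form [(0, Suc i, 1, f (xs ! i)), (0, 0, - \<epsilon>, 1)], xs)" for \<epsilon> i
  define \<Gamma> where "\<Gamma> = {cond \<epsilon> i | \<epsilon> i. \<epsilon> > 0 \<and> i < length xs}"
  have sat_cond: "value_at M (fst (cond \<epsilon> i)) ([y] @ xs) = 0 \<longleftrightarrow> \<bar>mdist M y (xs ! i) - f (xs ! i)\<bar> \<le> \<epsilon>"
    if "y \<in> mspace M" "i < length xs" for y \<epsilon> i
    using that by (auto simp: cond_def value_at_def val_dev_form)
  have "satisfied_in M 1 \<Gamma>"
  proof (rule sat[unfolded saturated_def, rule_format, of A], intro conjI allI impI)
    show "A \<subseteq> mspace M" by fact
    show "|A| <o \<kappa>"
      using fin \<kappa> by (meson finite_iff_ordLess_natLeq ordLess_transitive)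
    show "\<Gamma> \<subseteq> conditions_over A 1"
      using xs by (auto simp: \<Gamma>_def cond_def conditions_over_def formula_in_def fv_dev_form)
    fix \<Gamma>0 assume "finite \<Gamma>0 \<and> \<Gamma>0 \<subseteq> \<Gamma>"
    moreover have "\<Gamma> = (\<lambda>(\<epsilon>, i). cond \<epsilon> i) ` ({0<..} \<times> {..<length xs})"
      unfolding \<Gamma>_def by (auto simp: image_def)
    ultimately have "finite \<Gamma>0" "\<Gamma>0 \<subseteq> (\<lambda>(\<epsilon>, i). cond \<epsilon> i) ` ({0<..} \<times> {..<length xs})"
      by simp_all
    then obtain P where P: "P \<subseteq> {0<..} \<times> {..<length xs}" "finite P" "\<Gamma>0 = (\<lambda>(\<epsilon>, i). cond \<epsilon> i) ` P"
      by (meson finite_subset_image)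
    \<comment> \<open>The strictest of the finitely many tolerances; inserting 1 covers the case
      that there are none.\<close>
    define \<epsilon>0 where "\<epsilon>0 = Min (insert 1 (fst ` P))"
    have "\<epsilon>0 > 0" unfolding \<epsilon>0_def using P by (subst Min_gr_iff) auto
    have \<epsilon>0: "\<epsilon>0 \<le> \<epsilon>" if "(\<epsilon>, i) \<in> P" for \<epsilon> i
      unfolding \<epsilon>0_def using that P by (intro Min_le) force+
    have "\<exists>y\<in>mspace M. \<forall>i<length xs. \<bar>mdist M y (xs ! i) - f (xs ! i)\<bar> < \<epsilon>0"
      by (rule approximate_extension[OF U' M' real, where f = "\<lambda>i. f (xs ! i)"])
         (use nth sub f1 f2 \<open>\<epsilon>0 > 0\<close> in auto)
    then obtain y where y: "y \<in> mspace M" "\<And>i. i < length xs \<Longrightarrow> \<bar>mdist M y (xs ! i) - f (xs ! i)\<bar> < \<epsilon>0"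
      by blast
    have "value_at M (fst (cond \<epsilon> i)) ([y] @ xs) = 0" if "(\<epsilon>, i) \<in> P" for \<epsilon> i
    proof -
      have i: "i < length xs" using P(1) that by auto
      show ?thesis
        using y(2)[OF i] \<epsilon>0[OF that] by (subst sat_cond[OF y(1) i]) simp
    qed
    then show "satisfied_in M 1 \<Gamma>0"
      unfolding satisfied_in_def using y(1) P(3)
      by (intro exI[of _ "[y]"]) (auto simp: tuple_of_def cond_def)
  qed
  then obtain ys where ys: "tuple_of M 1 ys" "\<forall>(\<phi>, as)\<in>\<Gamma>. value_at M \<phi> (ys @ as) = 0"
    unfolding satisfied_in_def by blast
  then obtain y where y: "ys = [y]" "y \<in> mspace M"
    by (cases ys) (auto simp: tuple_of_def)
  have "mdist M y (xs ! i) = f (xs ! i)" if i: "i < length xs" for i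
  proof -
    have "\<bar>mdist M y (xs ! i) - f (xs ! i)\<bar> \<le> \<epsilon>" if "\<epsilon> > 0" for \<epsilon>
    proof -
      have "cond \<epsilon> i \<in> \<Gamma>" using i that by (auto simp: \<Gamma>_def)
      then have "value_at M (fst (cond \<epsilon> i)) ([y] @ xs) = 0"
        using ys(2) y(1) by (auto simp: cond_def)
      then show ?thesis using sat_cond[OF y(2) i] by simp
    qed
    then have "\<bar>mdist M y (xs ! i) - f (xs ! i)\<bar> \<le> 0"
      by (rule field_le_epsilon) simp
    then show ?thesis by simp
  qed
  then show "\<exists>y\<in>mspace M. \<forall>a\<in>A. mdist M y a = f a"
    using y(2) xs by (metis in_set_conv_nth)
qed

section \<open>Back-and-forth between isometric tuples\<close>

lemma finite_fv [simp]: "finite (fv \<phi>)"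
  by (induction \<phi>) auto

text \<open>The quantifier step: for each \<open>a\<close> the extension property gives a
  \<open>b\<close> with the same distances to the \<open>w j\<close> as \<open>a\<close> has to the
  \<open>v j\<close>. Exchanging \<open>v\<close> and \<open>w\<close> gives the reverse
  inclusion.\<close>

lemma val_image_isometric:
  assumes ext: "ext_property M" and diam: "diam_le_1 M"
    and IH: "\<And>v w. (\<And>j. j \<in> fv \<phi> \<Longrightarrow> v j \<in> mspace M) \<Longrightarrow> (\<And>j. j \<in> fv \<phi> \<Longrightarrow> w j \<in> mspace M) \<Longrightarrow>
      (\<And>j k. j \<in> fv \<phi> \<Longrightarrow> k \<in> fv \<phi> \<Longrightarrow> mdist M (v j) (v k) = mdist M (w j) (w k)) \<Longrightarrow>
      val M \<phi> v = val M \<phi> w"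
    and v: "\<And>j. j \<in> fv \<phi> - {i} \<Longrightarrow> v j \<in> mspace M"
    and w: "\<And>j. j \<in> fv \<phi> - {i} \<Longrightarrow> w j \<in> mspace M"
    and vw: "\<And>j k. j \<in> fv \<phi> - {i} \<Longrightarrow> k \<in> fv \<phi> - {i} \<Longrightarrow> mdist M (v j) (v k) = mdist M (w j) (w k)"
  shows "(\<lambda>a. val M \<phi> (v(i := a))) ` mspace M \<subseteq> (\<lambda>a. val M \<phi> (w(i := a))) ` mspace M"
proof
  fix r assume "r \<in> (\<lambda>a. val M \<phi> (v(i := a))) ` mspace M"
  then obtain a where a: "a \<in> mspace M" "r = val M \<phi> (v(i := a))" by blast
  obtain b where b: "b \<in> mspace M" "\<And>j. j \<in> fv \<phi> - {i} \<Longrightarrow> mdist M b (w j) = mdist M a (v j)"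
  proof (rule ext_property_indexed[OF ext, of "fv \<phi> - {i}" w "\<lambda>j. mdist M a (v j)"])
    fix j k assume jk: "j \<in> fv \<phi> - {i}" "k \<in> fv \<phi> - {i}"
    show "mdist M a (v j) \<le> mdist M a (v k) + mdist M (w j) (w k)"
      using mdist_triangle[OF a(1) v[OF jk(2)] v[OF jk(1)]] vw[OF jk] by (simp add: mdist_commute)
    show "mdist M (w j) (w k) \<le> mdist M a (v j) + mdist M a (v k)"
      using mdist_triangle[OF v[OF jk(1)] a(1) v[OF jk(2)]] vw[OF jk] by (simp add: mdist_commute)
  qed (use a v w diam in \<open>auto simp: diam_le_1_def\<close>)
  have "val M \<phi> (v(i := a)) = val M \<phi> (w(i := b))"
  proof (rule IH)
    fix j k assume "j \<in> fv \<phi>" "k \<in> fv \<phi>"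
    then show "mdist M ((v(i := a)) j) ((v(i := a)) k) = mdist M ((w(i := b)) j) ((w(i := b)) k)"
      using a(1) b vw mdist_commute[of M a "v j"] mdist_commute[of M b "w j"]
      by (cases "j = i"; cases "k = i") auto
  qed (use a b v w in auto)
  then show "r \<in> (\<lambda>a. val M \<phi> (w(i := a))) ` mspace M"
    using a b by auto
qed

text \<open>Quantifier elimination: the finite partial isometries form a back-and-forth system.\<close>

lemma val_isometric:
  assumes ext: "ext_property M" and diam: "diam_le_1 M"
  shows "(\<And>i. i \<in> fv \<phi> \<Longrightarrow> v i \<in> mspace M) \<Longrightarrow> (\<And>i. i \<in> fv \<phi> \<Longrightarrow> w i \<in> mspace M) \<Longrightarrow>
    (\<And>i j. i \<in> fv \<phi> \<Longrightarrow> j \<in> fv \<phi> \<Longrightarrow> mdist M (v i) (v j) = mdist M (w i) (w j)) \<Longrightarrow>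
    val M \<phi> v = val M \<phi> w"
proof (induction \<phi> arbitrary: v w)
  case (Conn u \<phi>s)
  have "val M \<phi> v = val M \<phi> w" if "\<phi> \<in> set \<phi>s" for \<phi>
  proof (rule Conn.IH[OF that])
    show "mdist M (v i) (v j) = mdist M (w i) (w j)" if "i \<in> fv \<phi>" "j \<in> fv \<phi>" for i j
      by (rule Conn.prems(3)) (use \<open>\<phi> \<in> set \<phi>s\<close> that in auto)
  qed (use Conn.prems(1,2) that in auto)
  then have "map (\<lambda>\<phi>. val M \<phi> v) \<phi>s = map (\<lambda>\<phi>. val M \<phi> w) \<phi>s"
    by simp
  then show ?case by (simp only: val.simps)
next
  case (SupQ i \<phi>)
  have "(\<lambda>a. val M \<phi> (v(i := a))) ` mspace M = (\<lambda>a. val M \<phi> (w(i := a))) ` mspace M"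
    using SupQ.prems by (intro equalityI val_image_isometric[OF ext diam SupQ.IH]) auto
  then show ?case by (simp only: val.simps)
next
  case (InfQ i \<phi>)
  have "(\<lambda>a. val M \<phi> (v(i := a))) ` mspace M = (\<lambda>a. val M \<phi> (w(i := a))) ` mspace M"
    using InfQ.prems by (intro equalityI val_image_isometric[OF ext diam InfQ.IH]) auto
  then show ?case by (simp only: val.simps)
qed simp

section \<open>Cyclic amalgamation\<close>

text \<open>
  \<open>\<eta> c i j\<close> plays the role of the distance from the \<open>i\<close>-th entry of some tuple to the \<open>j\<close>-th entry
  of the tuple \<open>c\<close> places later in an indiscernible sequence indexed by the integers.
\<close>

locale displacement =
  fixes n :: nat and \<eta> :: "int \<Rightarrow> nat \<Rightarrow> nat \<Rightarrow> real"
  assumes nonneg: "i < n \<Longrightarrow> j < n \<Longrightarrow> 0 \<le> \<eta> c i j"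
    and le_1: "i < n \<Longrightarrow> j < n \<Longrightarrow> \<eta> c i j \<le> 1"
    and refl: "i < n \<Longrightarrow> \<eta> 0 i i = 0"
    and sym: "i < n \<Longrightarrow> j < n \<Longrightarrow> \<eta> (- c) j i = \<eta> c i j"
    and triangle: "i < n \<Longrightarrow> j < n \<Longrightarrow> k < n \<Longrightarrow> \<eta> (c + c') i k \<le> \<eta> c i j + \<eta> c' j k"
    and diag: "i < n \<Longrightarrow> c \<noteq> 0 \<Longrightarrow> c' \<noteq> 0 \<Longrightarrow> \<eta> c i i = \<eta> c' i i"
begin

text \<open>The cycle of tuples prescribes distances only inside a tuple and between neighbours,
  hence steps in {-1, 0, 1}. The displacement is kept as an integer, that is, on the line that
  covers the cycle.\<close>

inductive walk :: "int \<Rightarrow> nat \<Rightarrow> nat \<Rightarrow> real \<Rightarrow> bool" where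
  refl_walk: "i < n \<Longrightarrow> walk 0 i i 0"
| step_walk: "walk c i j x \<Longrightarrow> s \<in> {-1, 0, 1} \<Longrightarrow> k < n \<Longrightarrow> walk (c + s) i k (x + \<eta> s j k)"

lemma walk_less: "walk c i j x \<Longrightarrow> i < n \<and> j < n"
  by (induction rule: walk.induct) auto

lemma walk_ge_eta: "walk c i j x \<Longrightarrow> \<eta> c i j \<le> x"
proof (induction rule: walk.induct)
  case (step_walk c i j x s k)
  then show ?case
    using triangle[of i j k c s] walk_less by fastforce
qed (simp add: refl)

lemma walk_nonneg: "walk c i j x \<Longrightarrow> 0 \<le> x"
  using walk_ge_eta nonneg walk_less by (meson order_trans)

lemma walk_single: "s \<in> {-1, 0, 1} \<Longrightarrow> i < n \<Longrightarrow> j < n \<Longrightarrow> walk s i j (\<eta> s i j)"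
  using step_walk[OF refl_walk, of i s j] by simp

lemma walk_trans: "walk c' j k y \<Longrightarrow> walk c i j x \<Longrightarrow> walk (c + c') i k (x + y)"
proof (induction rule: walk.induct)
  case (step_walk c' j k y s l)
  then show ?case
    using walk.step_walk[of "c + c'" i k "x + y" s l] by (simp add: add.assoc)
qed simp

lemma walk_sym: "walk c i j x \<Longrightarrow> walk (- c) j i x"
proof (induction rule: walk.induct)
  case (refl_walk i)
  then show ?case using walk.refl_walk by simp
next
  case (step_walk c i j x s k)
  have "walk (- s) k j (\<eta> (- s) k j)"
    using walk_single[of "- s" k j] step_walk walk_less by auto
  from walk_trans[OF step_walk.IH this] show ?case
    using sym[of j k s] step_walk walk_less by (auto simp: add.commute)
qed

text \<open>A walk that visits one index at two different positions can be rearranged to have any displacement.\<close>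

definition free :: "nat \<Rightarrow> nat \<Rightarrow> real \<Rightarrow> bool" where
  "free i j x \<longleftrightarrow> (\<forall>c. \<eta> c i j \<le> x)"

text \<open>Here \<open>P\<close> collects the visited positions, and \<open>\<tau> m\<close> is the
  index at the first visit to \<open>m\<close>; cutting the walk there bounds its length from below.
  Injectivity of \<open>\<tau>\<close> first fails when an index recurs at another position, and
  then the walk is free.\<close>

lemma free_or_injective_trace:
  assumes "walk c i j x"
  shows "free i j x \<or>
    (\<exists>P \<tau>. {min 0 c..max 0 c} \<subseteq> P \<and> inj_on \<tau> P \<and> \<tau> ` P \<subseteq> {..<n} \<and>
       (\<forall>m\<in>P. \<eta> m i (\<tau> m) + \<eta> (c - m) (\<tau> m) j \<le> x))"
  using assms
proof (induction rule: walk.induct)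
  case (refl_walk i)
  then show ?case
    by (intro disjI2 exI[of _ "{0}"] exI[of _ "\<lambda>_. i"]) (simp add: refl)
next
  case (step_walk c i j x s k)
  have ij: "i < n" "j < n" using walk_less step_walk by blast+
  have k: "k < n" by fact
  have free_step: "free i k (x + \<eta> s j k)" if "free i j x"
    unfolding free_def
  proof
    fix c'
    show "\<eta> c' i k \<le> x + \<eta> s j k"
      using triangle[OF ij k, of "c' - s" s] that[unfolded free_def, rule_format, of "c' - s"] by simp
  qed
  from step_walk.IH show ?case
  proof (elim disjE exE conjE)
    fix P \<tau>
    assume P: "{min 0 c..max 0 c} \<subseteq> P" "inj_on \<tau> P" "\<tau> ` P \<subseteq> {..<n}"
      and bd: "\<forall>m\<in>P. \<eta> m i (\<tau> m) + \<eta> (c - m) (\<tau> m) j \<le> x"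
    have bd': "\<eta> m i (\<tau> m) + \<eta> (c + s - m) (\<tau> m) k \<le> x + \<eta> s j k" if "m \<in> P" for m
    proof -
      have "\<tau> m < n" using P that by auto
      then show ?thesis
        using triangle[of "\<tau> m" j k "c - m" s] ij k bd that by (force simp: algebra_simps)
    qed
    \<comment> \<open>Steps of size at most 1 cannot skip a position.\<close>
    have seg: "{min 0 (c + s)..max 0 (c + s)} \<subseteq> insert (c + s) P"
    proof
      fix t assume "t \<in> {min 0 (c + s)..max 0 (c + s)}"
      then have "t = c + s \<or> t \<in> {min 0 c..max 0 c}"
        using \<open>s \<in> {-1, 0, 1}\<close> by (auto simp: min_def max_def split: if_splits)
      then show "t \<in> insert (c + s) P" using P(1) by blast
    qed
    consider "c + s \<in> P" | m where "c + s \<notin> P" "m \<in> P" "\<tau> m = k" | "c + s \<notin> P" "k \<notin> \<tau> ` P"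
      by blast
    then show ?thesis
    proof cases
      case 1
      then show ?thesis using P bd' seg by (intro disjI2 exI[of _ P] exI[of _ \<tau>]) auto
    next
      case 2
      have "free i k (x + \<eta> s j k)"
        unfolding free_def
      proof
        fix c'
        have b: "\<eta> m i k + \<eta> (c + s - m) k k \<le> x + \<eta> s j k"
          using bd'[OF 2(2)] 2(3) by simp
        \<comment> \<open>The walk contains \<open>k\<close> at positions \<open>m\<close> and
          \<open>c + s\<close>. By \<open>diag\<close>, the cost between the two also pays for going
          from \<open>k\<close> at \<open>m\<close> to \<open>k\<close> at any \<open>c'\<close>;
          for \<open>c' = m\<close> nothing is to be paid.\<close>
        have "c + s - m \<noteq> 0" using 2 by auto
        then have "\<eta> (c' - m) k k \<le> \<eta> (c + s - m) k k"
          using diag[OF k, of "c' - m" "c + s - m"] refl[OF k] nonneg[OF k k] by (cases "c' = m") auto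
        then show "\<eta> c' i k \<le> x + \<eta> s j k"
          using b triangle[OF ij(1) k k, of m "c' - m"] by simp
      qed
      then show ?thesis ..
    next
      case 3
      let ?\<tau> = "\<tau>(c + s := k)"
      have "\<eta> (c + s) i k \<le> x + \<eta> s j k"
        using walk_ge_eta[OF walk.step_walk] step_walk.hyps by blast
      then have "\<forall>m\<in>insert (c + s) P. \<eta> m i (?\<tau> m) + \<eta> (c + s - m) (?\<tau> m) k \<le> x + \<eta> s j k"
        using bd' 3 refl[OF k] by auto
      moreover have "inj_on ?\<tau> (insert (c + s) P)" "?\<tau> ` insert (c + s) P \<subseteq> {..<n}"
        using 3 P(2,3) k by (auto simp: inj_on_def image_iff)
      ultimately show ?thesis
        using seg by (intro disjI2 exI[of _ "insert (c + s) P"] exI[of _ ?\<tau>] conjI)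
    qed
  qed (use free_step in blast)
qed

text \<open>Pigeonhole: the segment from 0 to \<open>c\<close> has at least \<open>n + 1\<close>
  positions, too many for an injection into \<open>n\<close> indices.\<close>

lemma free_of_long_walk:
  assumes "walk c i j x" "\<bar>c\<bar> \<ge> int n"
  shows "free i j x"
proof (rule ccontr)
  assume "\<not> ?thesis"
  then obtain P \<tau> where P: "{min 0 c..max 0 c} \<subseteq> P" "inj_on \<tau> P" "\<tau> ` P \<subseteq> {..<n}"
    using free_or_injective_trace[OF assms(1)] by blast
  have "card {min 0 c..max 0 c} \<le> card {..<n}"
    by (rule card_inj_on_le[of \<tau>]) (use P in \<open>auto intro: inj_on_subset\<close>)
  then show False using assms(2) by (auto simp: min_def max_def split: if_splits)
qed

text \<open>Lengths of paths in the cycle of \<open>n + 1\<close> tuples. The element 1 truncates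
  the path pseudometric and keeps the set nonempty.\<close>

definition cyc_lengths :: "int \<Rightarrow> nat \<Rightarrow> nat \<Rightarrow> real set" where
  "cyc_lengths c i j = insert 1 {x. \<exists>c'. walk c' i j x \<and> int (n + 1) dvd c' - c}"

definition cyc :: "int \<Rightarrow> nat \<Rightarrow> nat \<Rightarrow> real" where
  "cyc c i j = Inf (cyc_lengths c i j)"

section \<open>The truncated path pseudometric of the cycle\<close>

lemma cyc_lengths_nonneg: "x \<in> cyc_lengths c i j \<Longrightarrow> 0 \<le> x"
  unfolding cyc_lengths_def using walk_nonneg by auto

lemma cyc_le: "x \<in> cyc_lengths c i j \<Longrightarrow> cyc c i j \<le> x"
  unfolding cyc_def by (intro cInf_lower) (auto intro: cyc_lengths_nonneg bdd_belowI)

lemma cyc_ge: "(\<And>x. x \<in> cyc_lengths c i j \<Longrightarrow> y \<le> x) \<Longrightarrow> y \<le> cyc c i j"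
  unfolding cyc_def by (intro cInf_greatest) (auto simp: cyc_lengths_def)

lemma cyc_le_1: "cyc c i j \<le> 1"
  by (rule cyc_le) (simp add: cyc_lengths_def)

lemma cyc_nonneg: "0 \<le> cyc c i j"
  by (rule cyc_ge) (rule cyc_lengths_nonneg)

lemma cyc_refl: "i < n \<Longrightarrow> cyc 0 i i = 0"
  by (intro antisym cyc_nonneg cyc_le) (auto simp: cyc_lengths_def intro!: exI[of _ 0] refl_walk)

lemma cyc_sym: "cyc (- c) j i = cyc c i j"
proof -
  have le: "cyc_lengths c i j \<subseteq> cyc_lengths (- c) j i" for c i j
  proof
    fix x assume "x \<in> cyc_lengths c i j"
    moreover have "int (n + 1) dvd - c' - (- c)" if "int (n + 1) dvd c' - c" for c'
      using that dvd_minus_iff[of "int (n + 1)" "c' - c"] by (simp add: algebra_simps)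
    ultimately show "x \<in> cyc_lengths (- c) j i"
      unfolding cyc_lengths_def using walk_sym by blast
  qed
  have "cyc_lengths (- c) j i = cyc_lengths c i j"
    using le[of c i j] le[of "- c" j i] by auto
  then show ?thesis by (simp add: cyc_def)
qed

lemma cyc_triangle: "cyc (c + c') i k \<le> cyc c i j + cyc c' j k"
proof -
  have "cyc (c + c') i k \<le> x + y" if x: "x \<in> cyc_lengths c i j" and y: "y \<in> cyc_lengths c' j k" for x y
  proof (cases "x = 1 \<or> y = 1")
    case True
    then show ?thesis
      using cyc_le_1[of "c + c'" i k] cyc_lengths_nonneg[OF x] cyc_lengths_nonneg[OF y] by linarith
  next
    case False
    then obtain d d' where "walk d i j x" "int (n + 1) dvd d - c" "walk d' j k y" "int (n + 1) dvd d' - c'"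
      using x y by (auto simp: cyc_lengths_def)
    then have "walk (d + d') i k (x + y)" "int (n + 1) dvd (d + d') - (c + c')"
      using walk_trans[of d' j k y d i x] dvd_add[of "int (n + 1)" "d - c" "d' - c'"]
      by (simp_all add: algebra_simps)
    then show ?thesis
      by (intro cyc_le) (auto simp: cyc_lengths_def)
  qed
  then have "cyc (c + c') i k - y \<le> cyc c i j" if "y \<in> cyc_lengths c' j k" for y
    by (intro cyc_ge) (use that in force)
  then have "cyc (c + c') i k - cyc c i j \<le> cyc c' j k"
    by (intro cyc_ge) force
  then show ?thesis by simp
qed

text \<open>A competing walk has displacement \<open>s\<close> plus a multiple of
  \<open>n + 1\<close>. If the multiple is 0, the triangle inequality bounds its length below;
  otherwise the walk winds around the cycle, is long, and hence free.\<close>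

lemma cyc_eq_eta:
  assumes "i < n" "j < n" "s \<in> {0, 1}" "int (n + 1) dvd c - s"
  shows "cyc c i j = \<eta> s i j"
proof (rule antisym)
  have "int (n + 1) dvd s - c"
    using assms(4) by (simp add: dvd_diff_commute)
  then show "cyc c i j \<le> \<eta> s i j"
    using walk_single[of s i j] assms by (intro cyc_le) (auto simp: cyc_lengths_def)
  show "\<eta> s i j \<le> cyc c i j"
  proof (rule cyc_ge)
    fix x assume "x \<in> cyc_lengths c i j"
    then consider "x = 1" | c' where "walk c' i j x" "int (n + 1) dvd c' - c"
      by (auto simp: cyc_lengths_def)
    then show "\<eta> s i j \<le> x"
    proof cases
      case 2
      have "int (n + 1) dvd c' - s"
        using dvd_add[OF 2(2) assms(4)] by simp
      then obtain t where t: "c' - s = int (n + 1) * t" by (elim dvdE)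
      show ?thesis
      proof (cases "t = 0")
        case True
        then show ?thesis using walk_ge_eta[OF 2(1)] t by simp
      next
        case False
        then have "int (n + 1) * 1 \<le> \<bar>int (n + 1) * t\<bar>"
          unfolding abs_mult by (intro mult_mono) auto
        \<comment> \<open>Since \<open>s\<close> is at most 1, a nonzero multiple of
          \<open>n + 1\<close> leaves at least \<open>n\<close>: here the length of the cycle
          enters.\<close>
        then have "\<bar>c'\<bar> \<ge> int n"
          using t assms(3) by auto
        from free_of_long_walk[OF 2(1) this] show ?thesis by (simp add: free_def)
      qed
    qed (use le_1 assms in auto)
  qed
qed

end

section \<open>Realizing configurations\<close>

text \<open>Points are chosen one after another: over the points already chosen, \<open>D s\<close>
  is a Katetov function.\<close>

lemma realize_pseudometric:
  fixes D :: "nat \<Rightarrow> nat \<Rightarrow> real"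
  assumes ext: "ext_property M"
    and le_1: "\<And>s t. D s t \<le> 1" and refl: "\<And>s. D s s = 0" and sym: "\<And>s t. D s t = D t s"
    and tri: "\<And>s t u. D s u \<le> D s t + D t u"
  obtains y where "\<And>s. y s \<in> mspace M" "\<And>s t. mdist M (y s) (y t) = D s t"
proof -
  define P where "P y s r \<longleftrightarrow> r \<in> mspace M \<and> (\<forall>t<s. mdist M r (y t) = D s t)" for y :: "nat \<Rightarrow> 'a" and s r
  have "\<exists>y. \<forall>s. P y s (y s)"
  proof (rule dependent_wellorder_choice)
    show "P f s r = P g s r" if "\<And>t. t < s \<Longrightarrow> f t = g t" for r f g s
      using that by (simp add: P_def)
    fix s and y :: "nat \<Rightarrow> 'a" assume IH: "\<And>t. t < s \<Longrightarrow> P y t (y t)"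
    have D: "mdist M (y t) (y u) = D t u" if "t < s" "u < s" for t u
    proof (cases t u rule: linorder_cases)
      case less
      then show ?thesis using IH[OF that(2)] sym[of t u] by (simp add: P_def mdist_commute)
    next
      case equal
      then show ?thesis using IH[OF that(1)] refl by (simp add: P_def)
    next
      case greater
      then show ?thesis using IH[OF that(1)] by (simp add: P_def)
    qed
    obtain r where "r \<in> mspace M" "\<And>t. t \<in> {..<s} \<Longrightarrow> mdist M r (y t) = D s t"
    proof (rule ext_property_indexed[OF ext, of "{..<s}" y "D s"])
      fix t u assume tu: "t \<in> {..<s}" "u \<in> {..<s}"
      show "D s t \<le> D s u + mdist M (y t) (y u)"
        using tri[of s t u] sym[of t u] tu by (simp add: D)
      show "mdist M (y t) (y u) \<le> D s t + D s u"
        using tri[of t u s] sym[of t s] tu by (simp add: D)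
    qed (use IH le_1 in \<open>auto simp: P_def\<close>)
    then show "\<exists>r. P y s r" by (auto simp: P_def)
  qed
  then obtain y where y: "\<And>s. y s \<in> mspace M" "\<And>s t. t < s \<Longrightarrow> mdist M (y s) (y t) = D s t"
    by (auto simp: P_def)
  have "mdist M (y s) (y t) = D s t" for s t
    using y refl sym[of s t] mdist_commute[of M "y s" "y t"]
    by (cases s t rule: linorder_cases) auto
  with y(1) show thesis by (rule that)
qed

text \<open>Entry \<open>i\<close> of tuple \<open>p\<close> is given the number
  \<open>p * n + i\<close>, which reduces the claim to a sequence of points.\<close>

lemma realize_tuples:
  fixes D :: "nat \<Rightarrow> nat \<Rightarrow> nat \<Rightarrow> nat \<Rightarrow> real"
  assumes ext: "ext_property M" and "n \<ge> 1"
    and le_1: "\<And>p i q j. i < n \<Longrightarrow> j < n \<Longrightarrow> D p i q j \<le> 1"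
    and refl: "\<And>p i. i < n \<Longrightarrow> D p i p i = 0"
    and sym: "\<And>p i q j. i < n \<Longrightarrow> j < n \<Longrightarrow> D p i q j = D q j p i"
    and tri: "\<And>p i q j r k. i < n \<Longrightarrow> j < n \<Longrightarrow> k < n \<Longrightarrow> D p i r k \<le> D p i q j + D q j r k"
  obtains b where "\<And>p. tuple_of M n (b p)"
    "\<And>p i q j. i < n \<Longrightarrow> j < n \<Longrightarrow> mdist M (b p ! i) (b q ! j) = D p i q j"
proof -
  have mod: "s mod n < n" for s using \<open>n \<ge> 1\<close> by simp
  obtain y where y: "\<And>s. y s \<in> mspace M"
      "\<And>s t. mdist M (y s) (y t) = D (s div n) (s mod n) (t div n) (t mod n)"
    using realize_pseudometric[OF ext, of "\<lambda>s t. D (s div n) (s mod n) (t div n) (t mod n)"]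
      le_1 refl sym tri mod by metis
  define b where "b p = map (\<lambda>i. y (p * n + i)) [0..<n]" for p
  have "tuple_of M n (b p)" for p
    using y(1) by (auto simp: tuple_of_def b_def)
  moreover have "mdist M (b p ! i) (b q ! j) = D p i q j" if "i < n" "j < n" for p i q j
    using that y(2) by (simp add: b_def)
  ultimately show thesis by (rule that)
qed

section \<open>From distances to formulas and indiscernibility\<close>

lemma value_at_isometric:
  assumes ext: "ext_property M" and diam: "diam_le_1 M"
    and \<phi>: "formula_in k \<phi>" and xs: "length xs = k" "set xs \<subseteq> mspace M"
    and ys: "length ys = k" "set ys \<subseteq> mspace M"
    and eq: "\<And>s t. s < k \<Longrightarrow> t < k \<Longrightarrow> mdist M (xs ! s) (xs ! t) = mdist M (ys ! s) (ys ! t)"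
  shows "value_at M \<phi> xs = value_at M \<phi> ys"
  unfolding value_at_def
proof (rule val_isometric[OF ext diam])
  have fv: "i < k" if "i \<in> fv \<phi>" for i
    using \<phi> that by (auto simp: formula_in_def)
  show "xs ! i \<in> mspace M" "ys ! i \<in> mspace M" if "i \<in> fv \<phi>" for i
    using fv[OF that] xs ys by auto
  show "mdist M (xs ! i) (xs ! j) = mdist M (ys ! i) (ys ! j)" if "i \<in> fv \<phi>" "j \<in> fv \<phi>" for i j
    using fv that eq by blast
qed

lemma concat_map_blocks:
  assumes "\<And>l. length (a l) = n"
  shows "length (concat (map a ls)) = length ls * n"
    and "s < length ls * n \<Longrightarrow> concat (map a ls) ! s = a (ls ! (s div n)) ! (s mod n)"
proof -
  show len: "length (concat (map a ls)) = length ls * n" for ls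
    by (induction ls) (auto simp: assms)
  show "s < length ls * n \<Longrightarrow> concat (map a ls) ! s = a (ls ! (s div n)) ! (s mod n)"
  proof (induction ls arbitrary: s)
    case (Cons l ls)
    show ?case
    proof (cases "s < n")
      case True
      then show ?thesis by (simp add: nth_append assms)
    next
      case False
      then have "n > 0" using Cons.prems by (cases n) auto
      then have "s div n = Suc ((s - n) div n)" "s mod n = (s - n) mod n"
        using False by (simp_all add: le_div_geq le_mod_geq)
      then show ?thesis
        using Cons False by (auto simp: nth_append assms)
    qed
  qed simp
qed

text \<open>By quantifier elimination it suffices that distances depend only on the order of the
  positions, which increasing lists of equal length share.\<close>

lemma indiscernibleI:
  assumes ext: "ext_property M" and diam: "diam_le_1 M" and a: "\<And>l. tuple_of M n (a l)"
    and order: "\<And>l m l' m' i j. i < n \<Longrightarrow> j < n \<Longrightarrow> l < m \<longleftrightarrow> l' < m' \<Longrightarrow> m < l \<longleftrightarrow> m' < l' \<Longrightarrow>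
      mdist M (a l ! i) (a m ! j) = mdist M (a l' ! i) (a m' ! j)"
  shows "indiscernible M n a"
  unfolding indiscernible_def
proof (intro conjI allI impI; (elim conjE)?)
  fix m \<phi> and ls ks :: "nat list"
  assume \<phi>: "formula_in (m * n) \<phi>" and ls: "length ls = m" "sorted_wrt (<) ls"
    and ks: "length ks = m" "sorted_wrt (<) ks"
  have len: "length (a l) = n" for l using a by (simp add: tuple_of_def)
  note nth = concat_map_blocks[of a, OF len]
  have set: "set (concat (map a xs)) \<subseteq> mspace M" for xs
    using a by (auto simp: tuple_of_def)
  show "value_at M \<phi> (concat (map a ls)) = value_at M \<phi> (concat (map a ks))"
  proof (rule value_at_isometric[OF ext diam \<phi>])
    fix s t assume st: "s < m * n" "t < m * n"
    have sorted_iff: "xs ! p < xs ! q \<longleftrightarrow> p < q"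
      if "sorted_wrt (<) xs" "length xs = m" "p < m" "q < m" for xs :: "nat list" and p q
      using that sorted_wrt_nth_less[OF that(1)] by (metis linorder_neqE_nat order_less_asym order_less_irrefl)
    have "s div n < m" "t div n < m" "s mod n < n" "t mod n < n"
      using st by (cases n; simp add: less_mult_imp_div_less)+
    then show "mdist M (concat (map a ls) ! s) (concat (map a ls) ! t) =
        mdist M (concat (map a ks) ! s) (concat (map a ks) ! t)"
      using st ls ks by (simp add: nth(2)) (intro order; simp add: sorted_iff)
  qed (use nth(1) set ls ks in auto)
qed (use a in auto)

lemma indiscernible_dist:
  assumes "indiscernible M n a" "i < n" "j < n" "l < m" "l' < m'"
  shows "mdist M (a l ! i) (a m ! j) = mdist M (a l' ! i) (a m' ! j)"
    and "mdist M (a l ! i) (a l ! j) = mdist M (a l' ! i) (a l' ! j)"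
proof -
  have len: "length (a l) = n" for l
    using assms(1) by (simp add: indiscernible_def tuple_of_def)
  have "value_at M (Dist i (n + j)) (concat (map a [l, m])) =
      value_at M (Dist i (n + j)) (concat (map a [l', m']))"
    using assms by (intro assms(1)[unfolded indiscernible_def, THEN conjunct2, rule_format, of 2])
      (auto simp: formula_in_def)
  then show "mdist M (a l ! i) (a m ! j) = mdist M (a l' ! i) (a m' ! j)"
    using assms by (simp add: value_at_def nth_append len)
  have "value_at M (Dist i j) (concat (map a [l])) = value_at M (Dist i j) (concat (map a [l']))"
    using assms by (intro assms(1)[unfolded indiscernible_def, THEN conjunct2, rule_format, of 1])
      (auto simp: formula_in_def)
  then show "mdist M (a l ! i) (a l ! j) = mdist M (a l' ! i) (a l' ! j)"
    using assms by (simp add: value_at_def nth_append len)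
qed

lemma cyclic_of_indiscernible:
  assumes ext: "ext_property M" and diam: "diam_le_1 M" and n: "n \<ge> 1"
    and ind: "indiscernible M n a"
  shows "cyclic M n (n + 1) a"
proof -
  have a: "length (a l) = n" "set (a l) \<subseteq> mspace M" for l
    using ind by (auto simp: indiscernible_def tuple_of_def)
  have pt: "a l ! i \<in> mspace M" if "i < n" for l i
    using a[of l] that by auto
  \<comment> \<open>One of \<open>nat (- c)\<close> and \<open>nat c\<close> is 0, so this compares
    two positions of displacement \<open>c\<close> without using negative ones.\<close>
  define \<eta> where "\<eta> c i j = mdist M (a (nat (- c)) ! i) (a (nat c) ! j)" for c i j
  have \<eta>: "\<eta> (int m - int l) i j = mdist M (a l ! i) (a m ! j)" if "i < n" "j < n" for l m i j
  proof (cases l m rule: linorder_cases)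
    case less
    then show ?thesis
      unfolding \<eta>_def by (intro indiscernible_dist(1)[OF ind that]) auto
  next
    case equal
    then show ?thesis
      unfolding \<eta>_def using indiscernible_dist(2)[OF ind that, of 0 1 l "Suc l"] by (auto intro: sym)
  next
    case greater
    then show ?thesis
      unfolding \<eta>_def mdist_commute[of M "_ ! i"]
      by (intro indiscernible_dist(1)[OF ind that(2,1)]) auto
  qed
  interpret displacement n \<eta>
  proof
    fix i j k :: nat and c c' :: int
    show "0 \<le> \<eta> c i j" by (simp add: \<eta>_def)
    show "\<eta> c i j \<le> 1" if "i < n" "j < n"
      using diam pt that by (simp add: \<eta>_def diam_le_1_def)
    show "\<eta> 0 i i = 0" if "i < n" using pt that by (simp add: \<eta>_def)
    show "\<eta> (- c) j i = \<eta> c i j" by (simp add: \<eta>_def mdist_commute)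
    show "\<eta> (c + c') i k \<le> \<eta> c i j + \<eta> c' j k" if "i < n" "j < n" "k < n"
    proof -
      \<comment> \<open>The starting position is so large that all three positions are natural
        numbers.\<close>
      define l where "l = nat (\<bar>c\<bar> + \<bar>c'\<bar>)"
      define m where "m = nat (int l + c)"
      define r where "r = nat (int l + c + c')"
      have "int m = int l + c" "int r = int l + c + c'"
        by (auto simp: l_def m_def r_def)
      then have eqs: "c + c' = int r - int l" "c = int m - int l" "c' = int r - int m" by simp_all
      show ?thesis
        unfolding eqs(1) unfolding eqs(2,3)
        by (simp only: \<eta>[OF that(1,2)] \<eta>[OF that(2,3)] \<eta>[OF that(1,3)])
           (intro mdist_triangle pt that)
    qed
    show "\<eta> c i i = \<eta> c' i i" if "i < n" "c \<noteq> 0" "c' \<noteq> 0"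
    proof -
      have "\<eta> c i i = \<eta> 1 i i" if "c \<noteq> 0" for c
      proof (cases "c > 0")
        case True
        then show ?thesis
          unfolding \<eta>_def by (intro indiscernible_dist(1)[OF ind \<open>i < n\<close> \<open>i < n\<close>]) auto
      next
        case False
        then show ?thesis
          unfolding \<eta>_def mdist_commute[of M "a (nat (- c)) ! i"] using \<open>c \<noteq> 0\<close>
          by (intro indiscernible_dist(1)[OF ind \<open>i < n\<close> \<open>i < n\<close>]) auto
      qed
      then show ?thesis using that by metis
    qed
  qed
  obtain b where b: "\<And>p. tuple_of M n (b p)"
    "\<And>p i q j. i < n \<Longrightarrow> j < n \<Longrightarrow> mdist M (b p ! i) (b q ! j) = cyc (int q - int p) i j"
  proof (rule realize_tuples[OF ext n, of "\<lambda>p i q j. cyc (int q - int p) i j"])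
    show "cyc (int q - int p) i j = cyc (int p - int q) j i" for p q i j
      using cyc_sym[of "int q - int p" j i] by simp
    show "cyc (int r - int p) i k \<le> cyc (int q - int p) i j + cyc (int r - int q) j k" for p q r i j k
      using cyc_triangle[of "int q - int p" "int r - int q" i k j] by simp
  qed (auto simp: cyc_le_1 cyc_refl)
  have len: "length (b p) = n" "set (b p) \<subseteq> mspace M" for p
    using b(1) by (auto simp: tuple_of_def)
  have "realizes M (b p @ b (Suc p mod (n + 1))) (tp M (a 0 @ a 1))" if "p < n + 1" for p
    unfolding realizes_def
  proof (intro conjI ballI)
    let ?q = "Suc p mod (n + 1)"
    show "set (b p @ b ?q) \<subseteq> mspace M" using len by simp
    \<comment> \<open>Passing from tuple \<open>n\<close> back to tuple 0 has displacement
      \<open>- n\<close>, which is congruent to 1 modulo \<open>n + 1\<close>.\<close>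
    have "int (n + 1) dvd int ?q - int p - 1"
    proof (cases "p = n")
      case True
      then have "int ?q - int p - 1 = - int (n + 1)" by simp
      then show ?thesis by (simp only: dvd_minus_iff dvd_refl)
    next
      case False
      then show ?thesis using that by simp
    qed
    then have d: "mdist M (b p ! i) (b ?q ! j) = mdist M (a 0 ! i) (a 1 ! j)"
      "mdist M (b r ! i) (b r ! j) = mdist M (a s ! i) (a s ! j)"
      if "i < n" "j < n" for i j r s
      using cyc_eq_eta[OF that, of 1 "int ?q - int p"] cyc_eq_eta[OF that, of 0 0] \<eta>[OF that, of 1 0]
        \<eta>[OF that, of s s] that b(2) by auto
    fix \<phi> assume \<phi>: "\<phi> \<in> tp M (a 0 @ a 1)"
    have "value_at M \<phi> (b p @ b ?q) = value_at M \<phi> (a 0 @ a 1)"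
    proof (rule value_at_isometric[OF ext diam])
      show "formula_in (n + n) \<phi>" using \<phi> by (simp add: tp_def a)
      fix s t assume "s < n + n" "t < n + n"
      then show "mdist M ((b p @ b ?q) ! s) ((b p @ b ?q) ! t) =
          mdist M ((a 0 @ a 1) ! s) ((a 0 @ a 1) ! t)"
        using d(1)[of s "t - n"] d(1)[of t "s - n"] d(2)[of s t p 0] d(2)[of "s - n" "t - n" ?q 1]
        by (simp add: nth_append len a)
           (metis add_diff_inverse_nat add_less_cancel_left mdist_commute)
    qed (use a len in auto)
    then show "value_at M \<phi> (b p @ b ?q) = 0" using \<phi> by (simp add: tp_def)
  qed
  then show ?thesis
    unfolding cyclic_def using b(1) by blast
qed

section \<open>A sequence that is not cyclic\<close>

text \<open>
  In the path metric whose edges of length \<open>1 / n\<close> join \<open>(p, i)\<close> to \<open>(q, i + 1)\<close> for \<open>p < q\<close>, a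
  shortest path between strictly comparable points is monotone, and other points cost one extra
  detour of two edges.
\<close>

definition zigzag :: "nat \<Rightarrow> nat \<Rightarrow> nat \<Rightarrow> nat \<Rightarrow> int" where
  "zigzag p i q j = \<bar>int i - int j\<bar> +
     (if p = q \<and> i = j \<or> p < q \<and> i < j \<or> q < p \<and> j < i then 0 else 2)"

text \<open>A detour in one leg pays for a detour in the sum. If both legs are monotone, either the
  composite is monotone, or the second coordinate turns back at \<open>j\<close>, which costs at
  least 2.\<close>

lemma zigzag_triangle: "zigzag p i r k \<le> zigzag p i q j + zigzag q j r k"
proof -
  let ?mono = "\<lambda>p i q j :: nat. p = q \<and> i = j \<or> p < q \<and> i < j \<or> q < p \<and> j < i"
  have abs: "\<bar>int i - int k\<bar> \<le> \<bar>int i - int j\<bar> + \<bar>int j - int k\<bar>" by linarith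
  have le: "zigzag p i r k \<le> \<bar>int i - int k\<bar> + 2" unfolding zigzag_def by simp
  have ge: "\<bar>int i - int j\<bar> \<le> zigzag p i q j" "\<bar>int j - int k\<bar> \<le> zigzag q j r k"
    unfolding zigzag_def by simp_all
  consider "\<not> ?mono p i q j" | "\<not> ?mono q j r k" | "?mono p i r k"
    | "i < j" "k < j" | "j < i" "j < k"
  proof -
    have "?mono p i r k \<or> i < j \<and> k < j \<or> j < i \<and> j < k"
      if "?mono p i q j" "?mono q j r k"
      using that by (elim disjE conjE) simp_all
    then show ?thesis using that by blast
  qed
  then show ?thesis
  proof cases
    case 1
    then have "zigzag p i q j = \<bar>int i - int j\<bar> + 2" unfolding zigzag_def by (simp only: if_False)
    then show ?thesis using abs le ge by linarith
  next
    case 2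
    then have "zigzag q j r k = \<bar>int j - int k\<bar> + 2" unfolding zigzag_def by (simp only: if_False)
    then show ?thesis using abs le ge by linarith
  next
    case 3
    then have "zigzag p i r k = \<bar>int i - int k\<bar>" unfolding zigzag_def by (simp only: if_True)
    then show ?thesis using abs ge by linarith
  next
    case 4
    then have "\<bar>int i - int k\<bar> + 2 \<le> \<bar>int i - int j\<bar> + \<bar>int j - int k\<bar>" by linarith
    then show ?thesis using le ge by linarith
  next
    case 5
    then have "\<bar>int i - int k\<bar> + 2 \<le> \<bar>int i - int j\<bar> + \<bar>int j - int k\<bar>" by linarith
    then show ?thesis using le ge by linarith
  qed
qed

lemma zigzag_nonneg: "0 \<le> zigzag p i q j"
  unfolding zigzag_def by simp

lemma zigzag_sym: "zigzag p i q j = zigzag q j p i"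
  unfolding zigzag_def abs_minus_commute[of "int i"] by (rule arg_cong[of _ _ "(+) _"]) (rule if_cong; blast)

text \<open>In a cycle of \<open>n\<close> tuples the entries \<open>b p ! p\<close> form a path of
  \<open>n - 1\<close> edges of length \<open>1 / n\<close>, yet the type puts its endpoints at
  distance 1.\<close>

lemma not_cyclic_indiscernible:
  assumes ext: "ext_property M" and diam: "diam_le_1 M" and n: "n \<ge> 1"
  shows "\<exists>a. indiscernible M n a \<and> \<not> cyclic M n n a"
proof -
  obtain a where a: "\<And>p. tuple_of M n (a p)"
    "\<And>p i q j. i < n \<Longrightarrow> j < n \<Longrightarrow> mdist M (a p ! i) (a q ! j) = min 1 (real_of_int (zigzag p i q j) / real n)"
  proof (rule realize_tuples[OF ext n, of "\<lambda>p i q j. min 1 (real_of_int (zigzag p i q j) / real n)"])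
    fix p i q j r k
    have "real_of_int (zigzag p i r k) / real n \<le> real_of_int (zigzag p i q j) / real n + real_of_int (zigzag q j r k) / real n"
      using zigzag_triangle[of p i r k q j]
      by (simp flip: add_divide_distrib of_int_add add: divide_right_mono)
    moreover have "0 \<le> real_of_int (zigzag p i q j) / real n" "0 \<le> real_of_int (zigzag q j r k) / real n"
      by (simp_all add: zigzag_nonneg)
    ultimately show "min 1 (real_of_int (zigzag p i r k) / real n) \<le>
        min 1 (real_of_int (zigzag p i q j) / real n) + min 1 (real_of_int (zigzag q j r k) / real n)"
      by linarith
    show "min 1 (real_of_int (zigzag p i q j) / real n) \<le> 1"
      "min 1 (real_of_int (zigzag p i p i) / real n) = 0"
      by (simp_all add: zigzag_def)
    show "min 1 (real_of_int (zigzag p i q j) / real n) = min 1 (real_of_int (zigzag q j p i) / real n)"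
      by (simp only: zigzag_sym[of p i])
  qed (rule that)
  have len: "length (a p) = n" for p using a(1) by (simp add: tuple_of_def)
  have "indiscernible M n a"
    by (rule indiscernibleI[OF ext diam a(1)]) (auto simp: a(2) zigzag_def)
  moreover have "\<not> cyclic M n n a"
  proof
    assume "cyclic M n n a"
    then obtain b where b: "\<And>p. p < n \<Longrightarrow> tuple_of M n (b p)"
      and real: "\<And>p. p < n \<Longrightarrow> realizes M (b p @ b (Suc p mod n)) (tp M (a 0 @ a 1))"
      by (auto simp: cyclic_def)
    have dist: "mdist M (b p ! i) (b (Suc p mod n) ! j) = mdist M (a 0 ! i) (a 1 ! j)"
      if "p < n" "i < n" "j < n" for p i j
    proof -
      \<comment> \<open>The truncated \<open>\<bar>d - r\<bar>\<close> vanishes only for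
        \<open>d = r\<close>, so the type fixes each distance.\<close>
      let ?\<phi> = "dev_form [(i, n + j, 1, mdist M (a 0 ! i) (a 1 ! j))]"
      have "?\<phi> \<in> tp M (a 0 @ a 1)"
        using that by (auto simp: tp_def formula_in_def fv_dev_form value_at_def val_dev_form nth_append len)
      then have "value_at M ?\<phi> (b p @ b (Suc p mod n)) = 0"
        using real[OF that(1)] by (auto simp: realizes_def)
      then show ?thesis
        using that b[OF that(1)]
        by (auto simp: value_at_def val_dev_form nth_append tuple_of_def min_def max_def split: if_splits)
    qed
    have step: "mdist M (b p ! p) (b (Suc p) ! Suc p) = 1 / n" if "Suc p < n" for p
      using dist[of p p "Suc p"] that a(2)[of p "Suc p" 0 1] by (simp add: zigzag_def min_def)
    have bp: "b p ! i \<in> mspace M" if "p < n" "i < n" for p i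
      using b[OF that(1)] that(2) by (auto simp: tuple_of_def)
    have path: "mdist M (b 0 ! 0) (b p ! p) \<le> real p / n" if "p < n" for p
      using that
    proof (induction p)
      case (Suc p)
      then show ?case
        using step[of p] n mdist_triangle[OF bp[of 0 0] bp[of p p] bp[of "Suc p" "Suc p"]]
        by (simp add: add_divide_distrib)
    qed (use bp[of 0 0] n in simp)
    \<comment> \<open>The closing pair goes forward in position and not up in index, so
      \<open>zigzag\<close> is \<open>n + 1\<close> and the distance is truncated to 1.\<close>
    have "mdist M (b (n - 1) ! (n - 1)) (b 0 ! 0) = 1"
      using dist[of "n - 1" "n - 1" 0] n a(2)[of "n - 1" 0 0 1] by (simp add: zigzag_def min_def)
    then show False
      using path[of "n - 1"] n by (simp add: mdist_commute)
  qed
  ultimately show ?thesis by blast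
qed

theorem theorem3p8:
  fixes U :: "'u metric" and M :: "'a metric" and \<kappa> :: "'k rel" and n :: nat
  assumes "urysohn_sphere U"
    and "monster_model \<kappa> (Th U) M"
    and "n \<ge> 1"
  shows "(\<forall>a. indiscernible M n a \<longrightarrow> cyclic M n (n + 1) a) \<and>
         (\<exists>a. indiscernible M n a \<and> \<not> cyclic M n n a)"
proof -
  have "ext_property M" "diam_le_1 M"
    using monster_ext_property[OF assms(1,2)] assms(2)
    by (simp_all add: monster_model_def model_of_def metric_structure_def)
  then show ?thesis
    using cyclic_of_indiscernible not_cyclic_indiscernible assms(3) by blast
qed

end
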